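(* Let $d\ge2$ and $1<p<\infty$. Then no nonempty open subspace of the metric space $W_p(\mathbf{R}^d)$ satisfies the projection criterion for non-positive curvature.
   Context: $W_p(\mathbf{R}^d)$ denotes the metric space $(\mathcal{P}_p(\mathbf{R}^d),W_p)$ of Borel probability measures on $\mathbf{R}^d$ with finite $p$-th moment, with the $p$-Wasserstein distance for the Euclidean norm; an open subspace carries the restricted metric. Geodesics are constant-speed minimizing geodesics parametrized by $[0,1]$; a subspace is geodesic if any two of its points are joined by a geodesic lying in it; a subset $S$ is geodesically convex if every geodesic joining two points of $S$ lies in $S$. For a subset $S$ of a metric space and a point $x$, $\mathrm{P}_S(x):=\{s\in S:\operatorname{dist}(x,s)=\operatorname{dist}(x,S)\}$. For $S\subseteq U\subseteq X$ with $X$ a metric space, $S$ is $U$-proximinal if $\mathrm{P}_S(x)$ is nonempty for all $x\in U$. A metric space $X$ satisfies the projection criterion for non-positive curvature if it admits an open cover $X=\bigcup_\alpha U_\alpha$ by geodesic subspaces such that, whenever $S\subseteq U_\alpha$ is geodesically convex and $U_\alpha$-proximinal, one has $\operatorname{dist}(\mathrm{P}_S(x),\mathrm{P}_S(y))\le\operatorname{dist}(x,y)$ for all $x,y\in U_\alpha$, where the distance between two sets is $\operatorname{dist}(A,B)=\inf_{a\in A,b\in B}\operatorname{dist}(a,b)$. *)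

theory Defs
  imports "HOL-Probability.Probability"
begin

section \<open>The Wasserstein space\<close>

definition prob_measures_moment :: "real \<Rightarrow> 'a::euclidean_space measure set" where
  "prob_measures_moment p =
     {\<mu>. prob_space \<mu> \<and> sets \<mu> = sets borel \<and> integrable \<mu> (\<lambda>x. norm x powr p)}"

definition couplings :: "'a::euclidean_space measure \<Rightarrow> 'a measure \<Rightarrow> ('a \<times> 'a) measure set" where
  "couplings \<mu> \<nu> =
     {\<gamma>. prob_space \<gamma> \<and> sets \<gamma> = sets borel \<and> distr \<gamma> borel fst = \<mu> \<and> distr \<gamma> borel snd = \<nu>}"

definition transport_cost :: "real \<Rightarrow> ('a::euclidean_space \<times> 'a) measure \<Rightarrow> ennreal" where
  "transport_cost p \<gamma> = (\<integral>\<^sup>+ z. ennreal (dist (fst z) (snd z) powr p) \<partial>\<gamma>)"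

text \<open>The infimum is finite when both measures have a finite \<open>p\<close>-th moment
  (see \<open>optimal_cost_finite\<close> below), so nothing is lost in the conversion to a real number.\<close>

definition wasserstein_dist ::
  "real \<Rightarrow> 'a::euclidean_space measure \<Rightarrow> 'a measure \<Rightarrow> real" where
  "wasserstein_dist p \<mu> \<nu> = enn2real (INF \<gamma>\<in>couplings \<mu> \<nu>. transport_cost p \<gamma>) powr (1 / p)"

text \<open>The constructor \<^const>\<open>metric\<close> is only meaningful on pairs that satisfy
  \<^const>\<open>Metric_space\<close>; for \<open>p \<ge> 1\<close> this is theorem \<open>Metric_space_wasserstein\<close> below.\<close>

definition wasserstein_space :: "real \<Rightarrow> 'a::euclidean_space measure metric" where
  "wasserstein_space p = metric (prob_measures_moment p, wasserstein_dist p)"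


section \<open>Geodesics, projections and the projection criterion\<close>

text \<open>Only the values of \<open>g\<close> on \<open>[0,1]\<close> matter.\<close>

definition geodesic_from_to :: "'b metric \<Rightarrow> (real \<Rightarrow> 'b) \<Rightarrow> 'b \<Rightarrow> 'b \<Rightarrow> bool" where
  "geodesic_from_to m g x y \<longleftrightarrow>
     g \<in> {0..1} \<rightarrow> mspace m \<and> g 0 = x \<and> g 1 = y \<and>
     (\<forall>s\<in>{0..1}. \<forall>t\<in>{0..1}. mdist m (g s) (g t) = \<bar>s - t\<bar> * mdist m x y)"

definition geodesic_space :: "'b metric \<Rightarrow> bool" where
  "geodesic_space m \<longleftrightarrow> (\<forall>x\<in>mspace m. \<forall>y\<in>mspace m. \<exists>g. geodesic_from_to m g x y)"

definition geodesically_convex :: "'b metric \<Rightarrow> 'b set \<Rightarrow> bool" where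
  "geodesically_convex m S \<longleftrightarrow>
     S \<subseteq> mspace m \<and>
     (\<forall>x\<in>S. \<forall>y\<in>S. \<forall>g. geodesic_from_to m g x y \<longrightarrow> g ` {0..1} \<subseteq> S)"

text \<open>As an infimum in \<^typ>\<open>real\<close> this is meaningful only if both sets are nonempty; in
  \<open>projection_criterion\<close> proximinality guarantees this for the two projections.\<close>

definition mset_dist :: "'b metric \<Rightarrow> 'b set \<Rightarrow> 'b set \<Rightarrow> real" where
  "mset_dist m A B = (INF (a, b)\<in>A \<times> B. mdist m a b)"

definition metric_proj :: "'b metric \<Rightarrow> 'b set \<Rightarrow> 'b \<Rightarrow> 'b set" where
  "metric_proj m S x = {s \<in> S. mdist m x s = mset_dist m {x} S}"

definition proximinal :: "'b metric \<Rightarrow> 'b set \<Rightarrow> 'b set \<Rightarrow> bool" where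
  "proximinal m U S \<longleftrightarrow> S \<subseteq> U \<and> U \<subseteq> mspace m \<and> (\<forall>x\<in>U. metric_proj m S x \<noteq> {})"

definition projection_criterion :: "'b metric \<Rightarrow> bool" where
  "projection_criterion m \<longleftrightarrow>
     (\<exists>\<U>. \<Union>\<U> = mspace m \<and>
        (\<forall>U\<in>\<U>. openin (mtopology_of m) U \<and> geodesic_space (submetric m U) \<and>
           (\<forall>S. S \<subseteq> U \<and> geodesically_convex m S \<and> proximinal m U S \<longrightarrow>
              (\<forall>x\<in>U. \<forall>y\<in>U.
                 mset_dist m (metric_proj m S x) (metric_proj m S y) \<le> mdist m x y))))"


section \<open>The Wasserstein distance is a metric\<close>

lemma measurable_fst_borel [measurable]:
  "fst \<in> (borel :: ('a::euclidean_space \<times> 'b::euclidean_space) measure) \<rightarrow>\<^sub>M borel"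
  by (simp add: borel_prod[symmetric])

lemma measurable_snd_borel [measurable]:
  "snd \<in> (borel :: ('a::euclidean_space \<times> 'b::euclidean_space) measure) \<rightarrow>\<^sub>M borel"
  by (simp add: borel_prod[symmetric])

lemma couplingsD:
  assumes "\<gamma> \<in> couplings \<mu> \<nu>"
  shows "prob_space \<gamma>" "sets \<gamma> = sets borel" "distr \<gamma> borel fst = \<mu>" "distr \<gamma> borel snd = \<nu>"
    "space \<gamma> = UNIV"
  using assms sets_eq_imp_space_eq[of \<gamma> borel] by (auto simp: couplings_def)

lemma couplings_distrI:
  fixes f g :: "'c \<Rightarrow> 'a::euclidean_space"
  assumes "prob_space M" and [measurable]: "f \<in> M \<rightarrow>\<^sub>M borel" "g \<in> M \<rightarrow>\<^sub>M borel"
    and "distr M borel f = \<mu>" "distr M borel g = \<nu>"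
  shows "distr M borel (\<lambda>x. (f x, g x)) \<in> couplings \<mu> \<nu>"
  unfolding couplings_def
  using assms by (auto simp: distr_distr comp_def intro!: prob_space.prob_space_distr)

lemma transport_cost_distr:
  fixes f g :: "'c \<Rightarrow> 'a::euclidean_space"
  assumes [measurable]: "f \<in> M \<rightarrow>\<^sub>M borel" "g \<in> M \<rightarrow>\<^sub>M borel"
  shows "transport_cost p (distr M borel (\<lambda>x. (f x, g x))) = (\<integral>\<^sup>+x. ennreal (dist (f x) (g x) powr p) \<partial>M)"
  unfolding transport_cost_def by (subst nn_integral_distr) auto

lemma coupling_swap:
  assumes "\<gamma> \<in> couplings \<mu> \<nu>"
  shows "\<exists>\<gamma>'\<in>couplings \<nu> \<mu>. transport_cost p \<gamma>' = transport_cost p \<gamma>"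
proof -
  note g = couplingsD[OF assms]
  have [measurable_cong]: "sets \<gamma> = sets borel" by fact
  have "distr \<gamma> borel (\<lambda>z. (snd z, fst z)) \<in> couplings \<nu> \<mu>"
    by (rule couplings_distrI) (use g in auto)
  moreover have "transport_cost p (distr \<gamma> borel (\<lambda>z. (snd z, fst z))) = transport_cost p \<gamma>"
    by (subst transport_cost_distr) (auto simp: transport_cost_def dist_commute)
  ultimately show ?thesis by blast
qed

lemma optimal_cost_commute:
  "(INF \<gamma>\<in>couplings \<mu> \<nu>. transport_cost p \<gamma>) = (INF \<gamma>\<in>couplings \<nu> \<mu>. transport_cost p \<gamma>)"
proof (rule antisym)
  show "(INF \<gamma>\<in>couplings \<mu> \<nu>. transport_cost p \<gamma>) \<le> (INF \<gamma>\<in>couplings \<nu> \<mu>. transport_cost p \<gamma>)"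
    for \<mu> \<nu> :: "'a::euclidean_space measure"
    by (rule INF_greatest) (metis coupling_swap INF_lower)
  then show "(INF \<gamma>\<in>couplings \<nu> \<mu>. transport_cost p \<gamma>) \<le> (INF \<gamma>\<in>couplings \<mu> \<nu>. transport_cost p \<gamma>)" .
qed

lemma prob_measures_momentD:
  assumes "\<mu> \<in> prob_measures_moment p"
  shows "prob_space \<mu>" "sets \<mu> = sets borel" "integrable \<mu> (\<lambda>x. norm x powr p)" "space \<mu> = UNIV"
  using assms sets_eq_imp_space_eq[of \<mu> borel] by (auto simp: prob_measures_moment_def)

lemma product_coupling:
  assumes "prob_space \<mu>" "sets \<mu> = sets borel" "prob_space \<nu>" "sets \<nu> = sets borel"
  shows "\<mu> \<Otimes>\<^sub>M \<nu> \<in> couplings \<mu> \<nu>"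
proof -
  interpret A: prob_space \<mu> by fact
  interpret B: prob_space \<nu> by fact
  interpret P: pair_prob_space \<mu> \<nu> ..
  have s: "sets (\<mu> \<Otimes>\<^sub>M \<nu>) = sets borel"
    using sets_pair_measure_cong[OF assms(2,4)] unfolding borel_prod .
  have 1: "distr (\<mu> \<Otimes>\<^sub>M \<nu>) borel fst = \<mu>"
    using B.distr_pair_fst[of \<mu>] assms(2) by (metis distr_cong)
  have "distr (\<mu> \<Otimes>\<^sub>M \<nu>) \<nu> snd = \<nu>"
  proof (rule measure_eqI)
    fix X assume "X \<in> sets (distr (\<mu> \<Otimes>\<^sub>M \<nu>) \<nu> snd)"
    then have X: "X \<in> sets \<nu>" by simp
    have "snd -` X \<inter> space (\<mu> \<Otimes>\<^sub>M \<nu>) = space \<mu> \<times> X"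
      using sets.sets_into_space[OF X] by (auto simp: space_pair_measure)
    then show "emeasure (distr (\<mu> \<Otimes>\<^sub>M \<nu>) \<nu> snd) X = emeasure \<nu> X"
      using X by (simp add: emeasure_distr B.emeasure_pair_measure_Times A.emeasure_space_1)
  qed simp
  then have 2: "distr (\<mu> \<Otimes>\<^sub>M \<nu>) borel snd = \<nu>"
    using assms(4) by (metis distr_cong)
  show ?thesis
    unfolding couplings_def using s 1 2 P.prob_space_axioms by auto
qed

theorem optimal_cost_finite:
  assumes "\<mu> \<in> prob_measures_moment p" "\<nu> \<in> prob_measures_moment p" "p \<ge> 0"
  shows "(INF \<gamma>\<in>couplings \<mu> \<nu>. transport_cost p \<gamma>) < \<infinity>"
proof -
  note m = prob_measures_momentD[OF assms(1)] and n = prob_measures_momentD[OF assms(2)]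
  define \<gamma> where "\<gamma> = \<mu> \<Otimes>\<^sub>M \<nu>"
  have g: "\<gamma> \<in> couplings \<mu> \<nu>"
    unfolding \<gamma>_def using m n by (intro product_coupling) auto
  note c = couplingsD[OF g]
  have [measurable_cong]: "sets \<gamma> = sets borel" by fact
  have pw: "dist x y powr p \<le> 2 powr p * (norm x powr p + norm y powr p)" for x y :: 'a
  proof -
    have "dist x y powr p \<le> (2 * max (norm x) (norm y)) powr p"
      using assms(3) norm_triangle_ineq4[of x y] by (intro powr_mono2) (auto simp: dist_norm)
    also have "\<dots> = 2 powr p * (max (norm x) (norm y)) powr p"
      by (simp add: powr_mult)
    also have "(max (norm x) (norm y)) powr p \<le> norm x powr p + norm y powr p"
      by (auto simp: max_def)
    finally show ?thesis by simp
  qed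
  have "transport_cost p \<gamma> \<le> (\<integral>\<^sup>+z. ennreal (2 powr p) * (ennreal (norm (fst z) powr p) + ennreal (norm (snd z) powr p)) \<partial>\<gamma>)"
    unfolding transport_cost_def
    by (intro nn_integral_mono) (use pw in \<open>simp add: ennreal_mult[symmetric] ennreal_plus[symmetric] del: ennreal_plus\<close>)
  also have "\<dots> = ennreal (2 powr p) * ((\<integral>\<^sup>+z. ennreal (norm (fst z) powr p) \<partial>\<gamma>) + (\<integral>\<^sup>+z. ennreal (norm (snd z) powr p) \<partial>\<gamma>))"
    by (simp add: nn_integral_cmult nn_integral_add)
  also have "(\<integral>\<^sup>+z. ennreal (norm (fst z) powr p) \<partial>\<gamma>) = (\<integral>\<^sup>+x. ennreal (norm x powr p) \<partial>distr \<gamma> borel fst)"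
    by (subst nn_integral_distr) auto
  also have "(\<integral>\<^sup>+z. ennreal (norm (snd z) powr p) \<partial>\<gamma>) = (\<integral>\<^sup>+x. ennreal (norm x powr p) \<partial>distr \<gamma> borel snd)"
    by (subst nn_integral_distr) auto
  also have "ennreal (2 powr p) * ((\<integral>\<^sup>+x. ennreal (norm x powr p) \<partial>distr \<gamma> borel fst) + (\<integral>\<^sup>+x. ennreal (norm x powr p) \<partial>distr \<gamma> borel snd)) < \<infinity>"
    using m(3) n(3) unfolding c
    by (auto simp: integrable_iff_bounded ennreal_mult_less_top)
  finally show ?thesis
    using g by (meson INF_lower le_less_trans)
qed

lemma wasserstein_less_imp_coupling:
  assumes "\<mu> \<in> prob_measures_moment p" "\<nu> \<in> prob_measures_moment p" "p > 0"
    "wasserstein_dist p \<mu> \<nu> < A"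
  obtains \<gamma> where "\<gamma> \<in> couplings \<mu> \<nu>" "transport_cost p \<gamma> < ennreal (A powr p)"
proof -
  let ?I = "INF \<gamma>\<in>couplings \<mu> \<nu>. transport_cost p \<gamma>"
  have fin: "?I < \<infinity>" using optimal_cost_finite[OF assms(1,2)] assms(3) by simp
  have A: "A > 0" using assms(4) unfolding wasserstein_dist_def
    by (meson le_less_trans powr_ge_zero)
  have "enn2real ?I = (enn2real ?I powr (1/p)) powr p"
    using assms(3) by (simp add: powr_powr)
  also have "\<dots> < A powr p"
    using assms(3,4) by (intro powr_less_mono2) (auto simp: wasserstein_dist_def)
  finally have "?I < ennreal (A powr p)"
    using fin A by (metis ennreal_enn2real ennreal_less_iff enn2real_nonneg infinity_ennreal_def)
  then show ?thesis using that unfolding INF_less_iff by blast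
qed

lemma wasserstein_le_if_coupling:
  assumes "\<gamma> \<in> couplings \<mu> \<nu>" "transport_cost p \<gamma> \<le> ennreal (A powr p)" "p > 0" "A \<ge> 0"
  shows "wasserstein_dist p \<mu> \<nu> \<le> A"
proof -
  have "(INF \<gamma>\<in>couplings \<mu> \<nu>. transport_cost p \<gamma>) \<le> ennreal (A powr p)"
    using assms(1,2) by (meson INF_lower order_trans)
  then have "enn2real (INF \<gamma>\<in>couplings \<mu> \<nu>. transport_cost p \<gamma>) \<le> A powr p"
    by (metis enn2real_ennreal enn2real_mono ennreal_less_top powr_ge_zero)
  then have "wasserstein_dist p \<mu> \<nu> \<le> (A powr p) powr (1/p)"
    unfolding wasserstein_dist_def using assms(3) by (intro powr_mono2) auto
  also have "\<dots> = A" using assms(3,4) by (simp add: powr_powr)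
  finally show ?thesis .
qed

lemma wasserstein_self:
  assumes "\<mu> \<in> prob_measures_moment p" "p > 0"
  shows "wasserstein_dist p \<mu> \<mu> = 0"
proof -
  note m = prob_measures_momentD[OF assms(1)]
  have [measurable_cong]: "sets \<mu> = sets borel" by fact
  have "distr \<mu> borel (\<lambda>x. x) = \<mu>" using m(2) by (metis distr_cong distr_id2)
  then have "distr \<mu> borel (\<lambda>x. (x, x)) \<in> couplings \<mu> \<mu>"
    using m by (intro couplings_distrI) auto
  moreover have "transport_cost p (distr \<mu> borel (\<lambda>x. (x, x))) \<le> ennreal (0 powr p)"
    by (subst transport_cost_distr) auto
  ultimately have "wasserstein_dist p \<mu> \<mu> \<le> 0"
    using assms(2) by (intro wasserstein_le_if_coupling) auto
  then show ?thesis
    by (simp add: wasserstein_dist_def)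
qed

lemma wasserstein_zero_closed_le:
  assumes "\<mu> \<in> prob_measures_moment p" "\<nu> \<in> prob_measures_moment p" "p > 0"
    and W: "wasserstein_dist p \<mu> \<nu> = 0" and C: "closed C" "C \<noteq> {}"
  shows "emeasure \<mu> C \<le> emeasure \<nu> C"
proof -
  note m = prob_measures_momentD[OF assms(1)] and n = prob_measures_momentD[OF assms(2)]
  interpret N: prob_space \<nu> by fact
  have [measurable_cong]: "sets \<mu> = sets borel" "sets \<nu> = sets borel" by fact+
  have Cm [measurable]: "C \<in> sets borel" using C by auto
  define D where "D e = {x. infdist x C \<le> e}" for e
  have Dm [measurable]: "D e \<in> sets borel" for e
    unfolding D_def by (intro borel_closed closed_Collect_le continuous_intros)
  have step: "emeasure \<mu> C \<le> emeasure \<nu> (D e) + ennreal e" if e: "e > 0" for e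
  proof -
    define A where "A = (e * e powr p) powr (1/p)"
    have A: "A > 0" "A powr p = e * e powr p"
      using e assms(3) by (auto simp: A_def powr_powr)
    obtain \<gamma> where g: "\<gamma> \<in> couplings \<mu> \<nu>" "transport_cost p \<gamma> < ennreal (A powr p)"
      using wasserstein_less_imp_coupling[OF assms(1-3), of A] W A(1) by auto
    note c = couplingsD[OF g(1)]
    have [measurable_cong]: "sets \<gamma> = sets borel" by fact
    define B where "B = {z::'a\<times>'a. dist (fst z) (snd z) > e}"
    have Bm [measurable]: "B \<in> sets \<gamma>"
      unfolding B_def c by measurable
    have "emeasure \<mu> C = emeasure \<gamma> (fst -` C)"
      unfolding c(3)[symmetric] by (subst emeasure_distr) (auto simp: c)
    also have "\<dots> \<le> emeasure \<gamma> (snd -` D e \<union> B)"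
    proof (rule emeasure_mono)
      show "fst -` C \<subseteq> snd -` D e \<union> B"
      proof
        fix z :: "'a \<times> 'a" assume "z \<in> fst -` C"
        then have "infdist (snd z) C \<le> dist (fst z) (snd z)"
          using infdist_le[of "fst z" C "snd z"] by (simp add: dist_commute)
        then show "z \<in> snd -` D e \<union> B" by (auto simp: D_def B_def)
      qed
      have "snd -` D e \<inter> space \<gamma> \<in> sets \<gamma>" by measurable
      then show "snd -` D e \<union> B \<in> sets \<gamma>" using Bm c(5) by auto
    qed
    also have "\<dots> \<le> emeasure \<gamma> (snd -` D e) + emeasure \<gamma> B"
    proof (rule emeasure_subadditive)
      have "snd -` D e \<inter> space \<gamma> \<in> sets \<gamma>" by measurable
      then show "snd -` D e \<in> sets \<gamma>" using c(5) by auto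
    qed (fact Bm)
    also have "emeasure \<gamma> (snd -` D e) = emeasure \<nu> (D e)"
      unfolding c(4)[symmetric] by (subst emeasure_distr) (auto simp: c)
    also have "emeasure \<gamma> B \<le> ennreal e"
    proof -
      have "ennreal (e powr p) * emeasure \<gamma> B = (\<integral>\<^sup>+z. ennreal (e powr p) * indicator B z \<partial>\<gamma>)"
        by (simp add: nn_integral_cmult_indicator)
      also have "\<dots> \<le> transport_cost p \<gamma>"
        unfolding transport_cost_def using e assms(3)
        by (intro nn_integral_mono)
          (auto simp: indicator_def B_def intro!: ennreal_leI powr_mono2)
      also have "\<dots> \<le> ennreal (e powr p) * ennreal e"
        using g(2) A(2) e by (simp add: ennreal_mult[symmetric] mult.commute)
      finally show ?thesis
        using e by (subst (asm) ennreal_mult_le_mult_iff) (auto simp: ennreal_eq_0_iff)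
    qed
    finally show ?thesis by (simp add: add_left_mono)
  qed
  define e where "e n = 1 / real (Suc n)" for n
  have e0: "e \<longlonglongrightarrow> 0" unfolding e_def by (rule LIMSEQ_Suc[OF lim_1_over_n])
  have int: "(\<Inter>n. D (e n)) = C"
  proof -
    have "x \<in> C" if "\<And>n. infdist x C \<le> e n" for x
    proof -
      have "infdist x C \<le> 0" using e0 by (rule LIMSEQ_le_const) (use that in auto)
      then have "infdist x C = 0" using infdist_nonneg[of x C] by simp
      then show ?thesis using C in_closed_iff_infdist_zero by blast
    qed
    moreover have "e n \<ge> 0" for n by (simp add: e_def)
    ultimately show ?thesis by (auto simp: D_def)
  qed
  have "(\<lambda>n. emeasure \<nu> (D (e n))) \<longlonglongrightarrow> emeasure \<nu> (\<Inter>n. D (e n))"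
  proof (rule Lim_emeasure_decseq)
    show "decseq (\<lambda>n. D (e n))"
      unfolding decseq_def D_def e_def
      by (auto elim!: order_trans simp: frac_le)
  qed (auto simp: N.emeasure_finite n)
  moreover have "(\<lambda>n. ennreal (e n)) \<longlonglongrightarrow> 0"
    using e0 tendsto_ennrealI by fastforce
  ultimately have "(\<lambda>n. emeasure \<nu> (D (e n)) + ennreal (e n)) \<longlonglongrightarrow> emeasure \<nu> C + 0"
    unfolding int by (intro tendsto_add)
  then show ?thesis
    by (intro LIMSEQ_le_const[of "\<lambda>n. emeasure \<nu> (D (e n)) + ennreal (e n)"])
      (auto intro!: exI[of _ 0] step simp: e_def)
qed

lemma wasserstein_commute: "wasserstein_dist p \<mu> \<nu> = wasserstein_dist p \<nu> \<mu>"
  by (simp only: wasserstein_dist_def optimal_cost_commute[of p \<mu>])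

lemma wasserstein_zero_imp_eq:
  assumes "\<mu> \<in> prob_measures_moment p" "\<nu> \<in> prob_measures_moment p" "p > 0"
    and W: "wasserstein_dist p \<mu> \<nu> = 0"
  shows "\<mu> = \<nu>"
proof (rule measure_eqI_generator_eq[where E="Collect closed" and \<Omega>=UNIV and A="\<lambda>_. UNIV"])
  note m = prob_measures_momentD[OF assms(1)] and n = prob_measures_momentD[OF assms(2)]
  interpret M: prob_space \<mu> by fact
  show "emeasure \<mu> X = emeasure \<nu> X" if "X \<in> Collect closed" for X
  proof (cases "X = {}")
    case False
    then show ?thesis
      using wasserstein_zero_closed_le[OF assms, of X] that
        wasserstein_zero_closed_le[OF assms(2,1,3), of X] W
      by (auto simp: wasserstein_commute[of p \<nu>] intro!: antisym)
  qed simp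
  show "sets \<mu> = sigma_sets UNIV (Collect closed)" "sets \<nu> = sigma_sets UNIV (Collect closed)"
    using m(2) n(2) by (simp_all add: borel_eq_closed)
  show "Int_stable (Collect closed)" by (auto simp: Int_stable_def)
  show "emeasure \<mu> UNIV \<noteq> \<infinity>" using M.emeasure_finite by auto
qed auto

text \<open>Minkowski's inequality, from the convexity of \<open>t powr p\<close>.\<close>

lemma powr_add_le_weighted:
  fixes a b A B p :: real
  assumes "a \<ge> 0" "b \<ge> 0" "A > 0" "B > 0" "p \<ge> 1"
  shows "(a + b) powr p \<le>
    (A + B) powr p * (A / (A + B) * (a powr p / A powr p) + B / (A + B) * (b powr p / B powr p))"
proof -
  define t where "t = B / (A + B)"
  have t: "0 < t" "t < 1" "1 - t = A / (A + B)" using assms by (auto simp: t_def field_simps)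
  have cv: "convex_on {0..} (\<lambda>x::real. x powr p)"
  proof (rule convex_onI)
    fix s x y :: real
    assume s: "0 < s" "s < 1" and x: "x \<in> {0..}" and y: "y \<in> {0..}"
    have le: "s powr p \<le> s" if "0 < s" "s < 1" for s :: real
      using powr_mono'[of 1 p s] that assms(5) by simp
    consider "x = 0" | "y = 0" | "x > 0" "y > 0" using x y by fastforce
    then show "((1 - s) *\<^sub>R x + s *\<^sub>R y) powr p \<le> (1 - s) * x powr p + s * y powr p"
    proof cases
      case 1
      then show ?thesis using le[of s] s y assms(5)
        by (simp add: powr_mult mult_right_mono)
    next
      case 2
      then show ?thesis using le[of "1 - s"] s x assms(5)
        by (simp add: powr_mult mult_right_mono)
    next
      case 3
      then show ?thesis
        using convex_onD[OF powr_convex[OF assms(5)], of s x y] s by simp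
    qed
  qed simp
  have "(1 - t) * (a / A) = a / (A + B)" "t * (b / B) = b / (A + B)"
    using assms unfolding t(3) by (simp_all add: t_def)
  then have "a + b = (A + B) * ((1 - t) * (a / A) + t * (b / B))"
    using assms by (simp add: add_divide_distrib[symmetric])
  then have "(a + b) powr p = (A + B) powr p * ((1 - t) * (a / A) + t * (b / B)) powr p"
    using assms t by (simp add: powr_mult)
  also have "((1 - t) * (a / A) + t * (b / B)) powr p \<le> (1 - t) * (a / A) powr p + t * (b / B) powr p"
    using convex_onD[OF cv, of t "a/A" "b/B"] t assms by simp
  finally show ?thesis
    using assms unfolding t(3) by (simp add: powr_divide t_def mult_left_mono)
qed

lemma nn_integral_Minkowski:
  fixes f g :: "'c \<Rightarrow> real"
  assumes [measurable]: "f \<in> borel_measurable M" "g \<in> borel_measurable M"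
    and nn: "\<And>x. f x \<ge> 0" "\<And>x. g x \<ge> 0" and AB: "A > 0" "B > 0" "p \<ge> 1"
    and f: "(\<integral>\<^sup>+x. ennreal (f x powr p) \<partial>M) \<le> ennreal (A powr p)"
    and g: "(\<integral>\<^sup>+x. ennreal (g x powr p) \<partial>M) \<le> ennreal (B powr p)"
  shows "(\<integral>\<^sup>+x. ennreal ((f x + g x) powr p) \<partial>M) \<le> ennreal ((A + B) powr p)"
proof -
  define u where "u = (A + B) powr p * (A / (A + B) / A powr p)"
  define v where "v = (A + B) powr p * (B / (A + B) / B powr p)"
  have uv: "u \<ge> 0" "v \<ge> 0" using AB by (auto simp: u_def v_def)
  have "(\<integral>\<^sup>+x. ennreal ((f x + g x) powr p) \<partial>M)
      \<le> (\<integral>\<^sup>+x. ennreal u * ennreal (f x powr p) + ennreal v * ennreal (g x powr p) \<partial>M)"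
  proof (rule nn_integral_mono)
    fix x
    have "(f x + g x) powr p \<le> u * f x powr p + v * g x powr p"
      using powr_add_le_weighted[OF nn(1)[of x] nn(2)[of x] AB]
      by (simp add: u_def v_def algebra_simps)
    then show "ennreal ((f x + g x) powr p) \<le> ennreal u * ennreal (f x powr p) + ennreal v * ennreal (g x powr p)"
      using uv by (simp add: ennreal_mult[symmetric] ennreal_plus[symmetric] ennreal_leI del: ennreal_plus)
  qed
  also have "\<dots> = ennreal u * (\<integral>\<^sup>+x. ennreal (f x powr p) \<partial>M) + ennreal v * (\<integral>\<^sup>+x. ennreal (g x powr p) \<partial>M)"
    by (simp add: nn_integral_add nn_integral_cmult)
  also have "\<dots> \<le> ennreal u * ennreal (A powr p) + ennreal v * ennreal (B powr p)"
    by (intro add_mono mult_left_mono f g) auto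
  also have "\<dots> = ennreal (u * A powr p + v * B powr p)"
    using uv by (simp add: ennreal_mult[symmetric] ennreal_plus[symmetric] del: ennreal_plus)
  also have "u * A powr p + v * B powr p = (A + B) powr p * (A / (A + B) + B / (A + B))"
  proof -
    have "u * A powr p = (A + B) powr p * (A / (A + B))" "v * B powr p = (A + B) powr p * (B / (A + B))"
      using AB by (auto simp: u_def v_def)
    then show ?thesis by (simp only: distrib_left)
  qed
  also have "A / (A + B) + B / (A + B) = 1" using AB by (simp add: add_divide_distrib[symmetric])
  finally show ?thesis by simp
qed

lemma countable_borel_mesh:
  assumes "e > 0"
  obtains N :: "'a::euclidean_space \<Rightarrow> nat"
  where "N \<in> borel \<rightarrow>\<^sub>M count_space UNIV" "\<And>x y. N x = N y \<Longrightarrow> dist x y \<le> e"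
proof -
  obtain D :: "'a set" where D: "countable D" "\<And>X. open X \<Longrightarrow> X \<noteq> {} \<Longrightarrow> \<exists>d\<in>D. d \<in> X"
    using countable_dense_exists by blast
  have "D \<noteq> {}" using D(2)[of UNIV] by auto
  define q where "q = from_nat_into D"
  have ex: "\<exists>k. dist (q k) x < e/2" for x
  proof -
    obtain d where "d \<in> D" "d \<in> ball x (e/2)" using D(2)[of "ball x (e/2)"] assms by auto
    then show ?thesis
      using from_nat_into_surj[OF D(1)] unfolding q_def by (metis dist_commute mem_ball)
  qed
  define N where "N x = (LEAST k. dist (q k) x < e/2)" for x
  have N: "dist (q (N x)) x < e/2" for x
    unfolding N_def using ex by (rule LeastI_ex)
  have "N \<in> borel \<rightarrow>\<^sub>M count_space UNIV"
    unfolding N_def by measurable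
  moreover have "dist x y \<le> e" if "N x = N y" for x y
    using dist_triangle3[of x y "q (N x)"] N[of x] N[of y] that by simp
  ultimately show ?thesis using that by blast
qed

text \<open>Gluing of two couplings along their common marginal, up to an error \<open>e\<close>.\<close>

lemma approximate_gluing:
  fixes \<gamma>1 \<gamma>2 :: "('a::euclidean_space \<times> 'a) measure"
  assumes g1: "\<gamma>1 \<in> couplings \<mu> \<nu>" and g2: "\<gamma>2 \<in> couplings \<nu> \<rho>" and e: "e > 0"
  obtains \<pi> :: "(('a \<times> 'a) \<times> ('a \<times> 'a)) measure"
  where "prob_space \<pi>" "sets \<pi> = sets borel" "distr \<pi> borel fst = \<gamma>1" "distr \<pi> borel snd = \<gamma>2"
    "AE w in \<pi>. dist (snd (fst w)) (fst (snd w)) \<le> e"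
proof -
  note c1 = couplingsD[OF g1] and c2 = couplingsD[OF g2]
  interpret A: prob_space \<gamma>1 by fact
  interpret B: prob_space \<gamma>2 by fact
  interpret P: pair_prob_space \<gamma>1 \<gamma>2 ..
  have [measurable_cong]: "sets \<gamma>1 = sets borel" "sets \<gamma>2 = sets borel" by fact+
  have s\<nu>: "sets \<nu> = sets borel" using c1(4) by auto
  have [measurable_cong]: "sets \<nu> = sets borel" by fact
  interpret N: prob_space \<nu>
    unfolding c1(4)[symmetric] by (rule A.prob_space_distr) simp
  obtain N :: "'a \<Rightarrow> nat" where Nm [measurable]: "N \<in> borel \<rightarrow>\<^sub>M count_space UNIV"
    and N: "\<And>x y. N x = N y \<Longrightarrow> dist x y \<le> e"
    using countable_borel_mesh[OF e] by blast
  define q where "q k = emeasure \<nu> {x \<in> space \<nu>. N x = k}" for k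
  define h where "h w = (if N (snd (fst w)) = N (fst (snd w)) then inverse (q (N (snd (fst w)))) else 0)"
    for w :: "('a \<times> 'a) \<times> ('a \<times> 'a)"
  have hm [measurable]: "h \<in> borel_measurable (\<gamma>1 \<Otimes>\<^sub>M \<gamma>2)"
  proof -
    have [measurable]: "(\<lambda>z. N (snd z)) \<in> \<gamma>1 \<rightarrow>\<^sub>M count_space UNIV"
      "(\<lambda>z. N (fst z)) \<in> \<gamma>2 \<rightarrow>\<^sub>M count_space UNIV"
      by measurable
    have n1: "(\<lambda>w. N (snd (fst w))) \<in> (\<gamma>1 \<Otimes>\<^sub>M \<gamma>2) \<rightarrow>\<^sub>M count_space UNIV"
      by (rule measurable_compose[OF measurable_fst]) measurable
    have n2: "(\<lambda>w. N (fst (snd w))) \<in> (\<gamma>1 \<Otimes>\<^sub>M \<gamma>2) \<rightarrow>\<^sub>M count_space UNIV"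
      by (rule measurable_compose[OF measurable_snd]) measurable
    have "{w \<in> space (\<gamma>1 \<Otimes>\<^sub>M \<gamma>2). N (snd (fst w)) = N (fst (snd w))}
        = (\<Union>k. ((\<lambda>w. N (snd (fst w))) -` {k} \<inter> space (\<gamma>1 \<Otimes>\<^sub>M \<gamma>2)) \<inter>
               ((\<lambda>w. N (fst (snd w))) -` {k} \<inter> space (\<gamma>1 \<Otimes>\<^sub>M \<gamma>2)))"
      by auto
    also have "\<dots> \<in> sets (\<gamma>1 \<Otimes>\<^sub>M \<gamma>2)"
      by (intro sets.countable_UN' sets.Int measurable_sets[OF n1] measurable_sets[OF n2]) auto
    finally show ?thesis
      unfolding h_def
      by (intro measurable_If measurable_const measurable_compose[OF n1, of "\<lambda>k. inverse (q k)"]) auto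
  qed
  define \<pi> where "\<pi> = density (\<gamma>1 \<Otimes>\<^sub>M \<gamma>2) h"
  have q_fin: "q k \<noteq> \<infinity>" for k
    unfolding q_def using N.emeasure_finite by simp
  have q_pos: "AE x in \<nu>. q (N x) \<noteq> 0"
  proof -
    have "AE x in \<nu>. \<forall>k. N x = k \<longrightarrow> q k \<noteq> 0"
      unfolding AE_all_countable
    proof
      fix k
      show "AE x in \<nu>. N x = k \<longrightarrow> q k \<noteq> 0"
      proof (cases "q k = 0")
        case True
        then have "AE x in \<nu>. x \<notin> {x \<in> space \<nu>. N x = k}"
          unfolding q_def by (intro AE_not_in null_setsI) auto
        then show ?thesis by (rule AE_mp) (auto intro!: AE_I2)
      qed auto
    qed
    then show ?thesis by auto
  qed
  have inv: "inverse (q k) * q k = 1" if "q k \<noteq> 0" for k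
    using ennreal_divide_self[OF that] q_fin[of k]
    by (simp add: divide_ennreal_def mult.commute less_top)
  have q1: "(\<integral>\<^sup>+z. (if N (snd z) = k then 1 else 0) \<partial>\<gamma>1) = q k" for k
  proof -
    have "(\<integral>\<^sup>+z. (if N (snd z) = k then 1 else 0) \<partial>\<gamma>1) = (\<integral>\<^sup>+x. (if N x = k then 1 else 0) \<partial>distr \<gamma>1 borel snd)"
      by (subst nn_integral_distr) auto
    also have "\<dots> = (\<integral>\<^sup>+x. indicator {x \<in> space \<nu>. N x = k} x \<partial>\<nu>)"
      unfolding c1(4) by (intro nn_integral_cong) (auto simp: indicator_def)
    finally show ?thesis by (simp add: q_def)
  qed
  have q2: "(\<integral>\<^sup>+z. (if N (fst z) = k then 1 else 0) \<partial>\<gamma>2) = q k" for k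
  proof -
    have "(\<integral>\<^sup>+z. (if N (fst z) = k then 1 else 0) \<partial>\<gamma>2) = (\<integral>\<^sup>+x. (if N x = k then 1 else 0) \<partial>distr \<gamma>2 borel fst)"
      by (subst nn_integral_distr) auto
    also have "\<dots> = (\<integral>\<^sup>+x. indicator {x \<in> space \<nu>. N x = k} x \<partial>\<nu>)"
      unfolding c2(3) by (intro nn_integral_cong) (auto simp: indicator_def)
    finally show ?thesis by (simp add: q_def)
  qed
  have ae1: "AE z in \<gamma>1. q (N (snd z)) \<noteq> 0"
    using q_pos unfolding c1(4)[symmetric] by (subst (asm) AE_distr_iff) auto
  have ae2: "AE z in \<gamma>2. q (N (fst z)) \<noteq> 0"
    using q_pos unfolding c2(3)[symmetric] by (subst (asm) AE_distr_iff) auto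
  have h1: "(\<integral>\<^sup>+z. h (x, z) \<partial>\<gamma>2) = inverse (q (N (snd x))) * q (N (snd x))" for x
  proof -
    have "(\<integral>\<^sup>+z. h (x, z) \<partial>\<gamma>2) = (\<integral>\<^sup>+z. inverse (q (N (snd x))) * (if N (fst z) = N (snd x) then 1 else 0) \<partial>\<gamma>2)"
      by (intro nn_integral_cong) (auto simp: h_def)
    then show ?thesis by (simp add: nn_integral_cmult q2)
  qed
  have h2: "(\<integral>\<^sup>+x. h (x, z) \<partial>\<gamma>1) = inverse (q (N (fst z))) * q (N (fst z))" for z
  proof -
    have "(\<integral>\<^sup>+x. h (x, z) \<partial>\<gamma>1) = (\<integral>\<^sup>+x. inverse (q (N (fst z))) * (if N (snd x) = N (fst z) then 1 else 0) \<partial>\<gamma>1)"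
      by (intro nn_integral_cong) (auto simp: h_def)
    then show ?thesis by (simp add: nn_integral_cmult q1)
  qed
  have sP: "sets (\<gamma>1 \<Otimes>\<^sub>M \<gamma>2) = sets borel"
    using sets_pair_measure_cong[OF c1(2) c2(2)] unfolding borel_prod .
  have spP: "space (\<gamma>1 \<Otimes>\<^sub>M \<gamma>2) = UNIV" by (simp add: space_pair_measure c1 c2)
  have s\<pi>: "sets \<pi> = sets borel" by (simp add: \<pi>_def sP)
  have m1: "distr \<pi> borel fst = \<gamma>1"
  proof (rule measure_eqI)
    fix X assume "X \<in> sets (distr \<pi> borel fst)"
    then have X [measurable]: "X \<in> sets \<gamma>1" by (simp add: c1)
    have "emeasure (distr \<pi> borel fst) X = emeasure \<pi> (fst -` X)"
      using X c1(2) s\<pi> by (subst emeasure_distr)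
        (auto simp: \<pi>_def spP measurable_cong_sets[OF sP refl])
    also have "\<dots> = (\<integral>\<^sup>+w. h w * indicator (fst -` X) w \<partial>(\<gamma>1 \<Otimes>\<^sub>M \<gamma>2))"
    proof -
      have "fst -` X \<inter> space (\<gamma>1 \<Otimes>\<^sub>M \<gamma>2) \<in> sets (\<gamma>1 \<Otimes>\<^sub>M \<gamma>2)" by measurable
      then show ?thesis unfolding \<pi>_def using spP by (subst emeasure_density) auto
    qed
    also have "\<dots> = (\<integral>\<^sup>+w. h w * indicator X (fst w) \<partial>(\<gamma>1 \<Otimes>\<^sub>M \<gamma>2))"
      by (intro nn_integral_cong) (auto simp: indicator_def)
    also have "\<dots> = (\<integral>\<^sup>+x. (\<integral>\<^sup>+z. h (x, z) * indicator X x \<partial>\<gamma>2) \<partial>\<gamma>1)"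
      by (subst B.nn_integral_fst[symmetric]) auto
    also have "\<dots> = (\<integral>\<^sup>+x. (inverse (q (N (snd x))) * q (N (snd x))) * indicator X x \<partial>\<gamma>1)"
    proof (rule nn_integral_cong)
      fix x assume x: "x \<in> space \<gamma>1"
      have "(\<lambda>z. h (x, z)) \<in> borel_measurable \<gamma>2"
        using hm x by simp
      then show "(\<integral>\<^sup>+z. h (x, z) * indicator X x \<partial>\<gamma>2) = (inverse (q (N (snd x))) * q (N (snd x))) * indicator X x"
        by (simp add: nn_integral_multc h1)
    qed
    also have "\<dots> = (\<integral>\<^sup>+x. indicator X x \<partial>\<gamma>1)"
      by (rule nn_integral_cong_AE) (use ae1 in eventually_elim, simp add: inv)
    finally show "emeasure (distr \<pi> borel fst) X = emeasure \<gamma>1 X" by simp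
  qed (simp add: c1)
  have m2: "distr \<pi> borel snd = \<gamma>2"
  proof (rule measure_eqI)
    fix X assume "X \<in> sets (distr \<pi> borel snd)"
    then have X [measurable]: "X \<in> sets \<gamma>2" by (simp add: c2)
    have "emeasure (distr \<pi> borel snd) X = emeasure \<pi> (snd -` X)"
      using X c2(2) s\<pi> by (subst emeasure_distr)
        (auto simp: \<pi>_def spP measurable_cong_sets[OF sP refl])
    also have "\<dots> = (\<integral>\<^sup>+w. h w * indicator (snd -` X) w \<partial>(\<gamma>1 \<Otimes>\<^sub>M \<gamma>2))"
    proof -
      have "snd -` X \<inter> space (\<gamma>1 \<Otimes>\<^sub>M \<gamma>2) \<in> sets (\<gamma>1 \<Otimes>\<^sub>M \<gamma>2)" by measurable
      then show ?thesis unfolding \<pi>_def using spP by (subst emeasure_density) auto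
    qed
    also have "\<dots> = (\<integral>\<^sup>+w. h w * indicator X (snd w) \<partial>(\<gamma>1 \<Otimes>\<^sub>M \<gamma>2))"
      by (intro nn_integral_cong) (auto simp: indicator_def)
    also have "\<dots> = (\<integral>\<^sup>+z. (\<integral>\<^sup>+x. h (x, z) * indicator X z \<partial>\<gamma>1) \<partial>\<gamma>2)"
      by (subst P.nn_integral_snd[symmetric]) auto
    also have "\<dots> = (\<integral>\<^sup>+z. (inverse (q (N (fst z))) * q (N (fst z))) * indicator X z \<partial>\<gamma>2)"
    proof (rule nn_integral_cong)
      fix z assume z: "z \<in> space \<gamma>2"
      have "(\<lambda>x. h (x, z)) \<in> borel_measurable \<gamma>1"
        using hm z by simp
      then show "(\<integral>\<^sup>+x. h (x, z) * indicator X z \<partial>\<gamma>1) = (inverse (q (N (fst z))) * q (N (fst z))) * indicator X z"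
        by (simp add: nn_integral_multc h2)
    qed
    also have "\<dots> = (\<integral>\<^sup>+x. indicator X x \<partial>\<gamma>2)"
      by (rule nn_integral_cong_AE) (use ae2 in eventually_elim, simp add: inv)
    finally show "emeasure (distr \<pi> borel snd) X = emeasure \<gamma>2 X" by simp
  qed (simp add: c2)
  have pr: "prob_space \<pi>"
  proof
    have "emeasure \<pi> (space \<pi>) = emeasure (distr \<pi> borel fst) UNIV"
      using s\<pi> sets_eq_imp_space_eq[OF s\<pi>] by (subst emeasure_distr) (auto simp: measurable_cong_sets[OF s\<pi> refl])
    then show "emeasure \<pi> (space \<pi>) = 1" using A.emeasure_space_1 c1(5) m1 by simp
  qed
  have "AE w in \<pi>. dist (snd (fst w)) (fst (snd w)) \<le> e"
    unfolding \<pi>_def by (subst AE_density) (auto simp: h_def intro!: AE_I2 N split: if_splits)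
  with pr s\<pi> m1 m2 show ?thesis using that by blast
qed

lemma wasserstein_triangle:
  assumes "\<mu> \<in> prob_measures_moment p" "\<nu> \<in> prob_measures_moment p"
    "\<rho> \<in> prob_measures_moment p" "p \<ge> 1"
  shows "wasserstein_dist p \<mu> \<rho> \<le> wasserstein_dist p \<mu> \<nu> + wasserstein_dist p \<nu> \<rho>"
proof (rule field_le_epsilon)
  fix d :: real assume "d > 0"
  define e where "e = d / 3"
  have e: "e > 0" using \<open>d > 0\<close> by (simp add: e_def)
  have p: "p > 0" using assms(4) by simp
  define A B where "A = wasserstein_dist p \<mu> \<nu> + e" and "B = wasserstein_dist p \<nu> \<rho> + e"
  have AB: "A > 0" "B > 0" using e by (auto simp: A_def B_def wasserstein_dist_def add_nonneg_pos)
  obtain \<gamma>1 where g1: "\<gamma>1 \<in> couplings \<mu> \<nu>" "transport_cost p \<gamma>1 < ennreal (A powr p)"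
    using wasserstein_less_imp_coupling[OF assms(1,2) p, of A] e by (auto simp: A_def)
  obtain \<gamma>2 where g2: "\<gamma>2 \<in> couplings \<nu> \<rho>" "transport_cost p \<gamma>2 < ennreal (B powr p)"
    using wasserstein_less_imp_coupling[OF assms(2,3) p, of B] e by (auto simp: B_def)
  obtain \<pi> where pi: "prob_space \<pi>" "sets \<pi> = sets borel"
      "distr \<pi> borel fst = \<gamma>1" "distr \<pi> borel snd = \<gamma>2"
      "AE w in \<pi>. dist (snd (fst w)) (fst (snd w)) \<le> e"
    using approximate_gluing[OF g1(1) g2(1) e] by blast
  interpret prob_space \<pi> by fact
  have [measurable_cong]: "sets \<pi> = sets borel" by fact
  define d1 where "d1 w = dist (fst (fst w)) (snd (fst w))" for w :: "('a\<times>'a)\<times>('a\<times>'a)"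
  define d2 where "d2 w = dist (fst (snd w)) (snd (snd w))" for w :: "('a\<times>'a)\<times>('a\<times>'a)"
  have [measurable]: "d1 \<in> borel_measurable \<pi>" "d2 \<in> borel_measurable \<pi>"
    unfolding d1_def d2_def by measurable
  have i1: "(\<integral>\<^sup>+w. ennreal (d1 w powr p) \<partial>\<pi>) \<le> ennreal (A powr p)"
    using g1(2) unfolding transport_cost_def pi(3)[symmetric]
    by (subst (asm) nn_integral_distr) (auto simp: d1_def)
  have i2: "(\<integral>\<^sup>+w. ennreal (d2 w powr p) \<partial>\<pi>) \<le> ennreal (B powr p)"
    using g2(2) unfolding transport_cost_def pi(4)[symmetric]
    by (subst (asm) nn_integral_distr) (auto simp: d2_def)
  have i3: "(\<integral>\<^sup>+w. ennreal ((d1 w + e) powr p) \<partial>\<pi>) \<le> ennreal ((A + e) powr p)"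
    using AB e assms(4) emeasure_space_1
    by (intro nn_integral_Minkowski i1) (auto simp: d1_def)
  have i4: "(\<integral>\<^sup>+w. ennreal ((d1 w + e + d2 w) powr p) \<partial>\<pi>) \<le> ennreal ((A + e + B) powr p)"
    using AB e assms(4)
    by (intro nn_integral_Minkowski i2 i3) (auto simp: d1_def d2_def)
  define \<gamma> where "\<gamma> = distr \<pi> borel (\<lambda>w. (fst (fst w), snd (snd w)))"
  have "\<gamma> \<in> couplings \<mu> \<rho>"
    unfolding \<gamma>_def
  proof (rule couplings_distrI)
    show "distr \<pi> borel (\<lambda>w. fst (fst w)) = \<mu>"
      using couplingsD(3)[OF g1(1)] unfolding pi(3)[symmetric]
      by (subst (asm) distr_distr) (auto simp: comp_def)
    show "distr \<pi> borel (\<lambda>w. snd (snd w)) = \<rho>"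
      using couplingsD(4)[OF g2(1)] unfolding pi(4)[symmetric]
      by (subst (asm) distr_distr) (auto simp: comp_def)
  qed (auto intro: pi)
  moreover have "transport_cost p \<gamma> \<le> ennreal ((A + e + B) powr p)"
  proof -
    have "transport_cost p \<gamma> \<le> (\<integral>\<^sup>+w. ennreal ((d1 w + e + d2 w) powr p) \<partial>\<pi>)"
      unfolding \<gamma>_def
    proof (subst transport_cost_distr)
      show "(\<integral>\<^sup>+w. ennreal (dist (fst (fst w)) (snd (snd w)) powr p) \<partial>\<pi>)
          \<le> (\<integral>\<^sup>+w. ennreal ((d1 w + e + d2 w) powr p) \<partial>\<pi>)"
      proof (rule nn_integral_mono_AE, use pi(5) in eventually_elim)
        fix w :: "('a\<times>'a)\<times>('a\<times>'a)"
        assume "dist (snd (fst w)) (fst (snd w)) \<le> e"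
        then have "dist (fst (fst w)) (snd (snd w)) \<le> d1 w + e + d2 w"
          using dist_triangle[of "fst (fst w)" "snd (snd w)" "snd (fst w)"]
            dist_triangle[of "snd (fst w)" "snd (snd w)" "fst (snd w)"]
          by (simp add: d1_def d2_def)
        then show "ennreal (dist (fst (fst w)) (snd (snd w)) powr p) \<le> ennreal ((d1 w + e + d2 w) powr p)"
          using p by (intro ennreal_leI powr_mono2) auto
      qed
    qed auto
    then show ?thesis using i4 by simp
  qed
  ultimately have "wasserstein_dist p \<mu> \<rho> \<le> A + e + B"
    using AB e p by (intro wasserstein_le_if_coupling) auto
  then show "wasserstein_dist p \<mu> \<rho> \<le> wasserstein_dist p \<mu> \<nu> + wasserstein_dist p \<nu> \<rho> + d"
    by (simp add: A_def B_def e_def)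
qed

theorem Metric_space_wasserstein:
  assumes "p \<ge> 1"
  shows "Metric_space (prob_measures_moment p :: 'a::euclidean_space measure set) (wasserstein_dist p)"
proof
  have p: "p > 0" using assms by simp
  fix \<mu> \<nu> \<rho> :: "'a measure"
  show "0 \<le> wasserstein_dist p \<mu> \<nu>" by (simp add: wasserstein_dist_def)
  show "wasserstein_dist p \<mu> \<nu> = wasserstein_dist p \<nu> \<mu>" by (rule wasserstein_commute)
  assume "\<mu> \<in> prob_measures_moment p" "\<nu> \<in> prob_measures_moment p"
  then show "wasserstein_dist p \<mu> \<nu> = 0 \<longleftrightarrow> \<mu> = \<nu>"
    using wasserstein_zero_imp_eq wasserstein_self p by metis
next
  fix \<mu> \<nu> \<rho> :: "'a measure"
  assume "\<mu> \<in> prob_measures_moment p" "\<nu> \<in> prob_measures_moment p" "\<rho> \<in> prob_measures_moment p"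
  then show "wasserstein_dist p \<mu> \<rho> \<le> wasserstein_dist p \<mu> \<nu> + wasserstein_dist p \<nu> \<rho>"
    using assms by (rule wasserstein_triangle)
qed

theorem mspace_wasserstein_space:
  "p \<ge> 1 \<Longrightarrow> mspace (wasserstein_space p) = prob_measures_moment p"
  unfolding wasserstein_space_def by (intro Metric_space.mspace_metric Metric_space_wasserstein)

theorem mdist_wasserstein_space:
  "p \<ge> 1 \<Longrightarrow> mdist (wasserstein_space p) = wasserstein_dist p"
  unfolding wasserstein_space_def by (intro Metric_space.mdist_metric Metric_space_wasserstein)

end

theory Submission
  imports Defs
begin

text \<open>
  Every measure can be approximated by one that puts no mass on a ball \<open>B\<close> of radius \<open>r\<close> around
  the origin, and then by measures \<open>\<rho> v\<close> in which a further small mass \<open>e\<close> is split evenly between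
  \<open>v\<close> and \<open>- v\<close>. As long as \<open>v\<close> and \<open>w\<close> are much shorter than \<open>r\<close>, transporting
  \<open>\<rho> v\<close> to \<open>\<rho> w\<close> leaves the mass outside \<open>B\<close> alone, so that the distance is
  \<open>e powr (1/p) * min (norm (v - w)) (norm (v + w))\<close>: every open set contains a scaled copy of a
  neighbourhood of the apex of the cone \<open>V/{1,-1}\<close>, whose positive curvature violates the
  criterion. For orthonormal \<open>a\<close>, \<open>b\<close>, the points \<open>a/4 + b/2\<close> and \<open>a/4 - b/2\<close> are at
  distance \<open>1/2\<close> in the cone, but their nearest points \<open>a + b/2\<close> and \<open>a - b/2\<close> on the segment
  \<open>a + s b\<close>, \<open>\<bar>s\<bar> \<le> 1/2\<close>, are at distance \<open>1\<close>.

  The segment is geodesically convex in the whole Wasserstein space because the geodesic between two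
  of its points is unique: adding up the dual bounds for the two halves of a geodesic forces an
  intermediate measure to live outside \<open>B\<close> except for two atoms, and it makes the first
  half optimal for an explicit potential, which identifies the measure.
\<close>

section \<open>Strict convexity of powers and of the Euclidean norm\<close>

lemma powr_strict_tangent:
  fixes x L p :: real
  assumes "1 < p" "0 < L" "0 \<le> x" "x \<noteq> L"
  shows "L powr p + p * L powr (p - 1) * (x - L) < x powr p"
proof (cases "x = 0")
  \<comment> \<open>The derivative of \<open>powr\<close> is taken at positive points only, so the
    endpoint 0 is computed directly: the tangent at \<open>L\<close> has the negative value
    \<open>(1 - p) * L powr p\<close> there.\<close>
  case True
  have "L powr p = L powr (p - 1) * L"
    using assms(2) by (simp add: powr_mult_base mult.commute)
  then have "L powr p + p * L powr (p - 1) * (x - L) = (1 - p) * L powr p"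
    using True by (simp add: algebra_simps)
  also have "\<dots> < 0"
    using assms by (simp add: mult_neg_pos)
  finally show ?thesis using True by simp
next
  case False
  then have x: "x > 0" using assms by simp
  have D: "((\<lambda>y. y powr p) has_real_derivative p * y powr (p - 1)) (at y)" if "y > 0" for y :: real
    using that by (auto intro!: derivative_eq_intros)
  show ?thesis
  proof (cases "x < L")
    case True
    obtain z where z: "x < z" "z < L" "L powr p - x powr p = (L - x) * (p * z powr (p - 1))"
      using MVT2[OF True, of "\<lambda>y. y powr p" "\<lambda>y. p * y powr (p - 1)"] D x by force
    have "(L - x) * (p * z powr (p - 1)) < (L - x) * (p * L powr (p - 1))"
      using True z x assms by (intro mult_strict_left_mono powr_less_mono2) auto
    then show ?thesis using z(3) by (simp add: algebra_simps)
  next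
    case False
    then have Lx: "L < x" using assms by simp
    obtain z where z: "L < z" "z < x" "x powr p - L powr p = (x - L) * (p * z powr (p - 1))"
      using MVT2[OF Lx, of "\<lambda>y. y powr p" "\<lambda>y. p * y powr (p - 1)"] D assms by force
    have "(x - L) * (p * L powr (p - 1)) < (x - L) * (p * z powr (p - 1))"
      using Lx z assms by (intro mult_strict_left_mono powr_less_mono2) auto
    then show ?thesis using z(3) by (simp add: algebra_simps)
  qed
qed

text \<open>This is convexity at the points \<open>a / t\<close> and \<open>b / (1 - t)\<close> with
  weights \<open>t\<close> and \<open>1 - t\<close>; the factors \<open>t powr (1 - p)\<close> and
  \<open>(1 - t) powr (1 - p)\<close> are those that make the costs of the two halves of a geodesic
  add up to the whole. The strict tangent inequality gives the equality case.\<close>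

lemma powr_convex_split:
  fixes a b t L p :: real
  assumes "1 < p" "0 < L" "0 \<le> a" "0 \<le> b" "0 < t" "t < 1" "L \<le> a + b"
  shows "L powr p \<le> t powr (1 - p) * a powr p + (1 - t) powr (1 - p) * b powr p" (is "_ \<le> ?R")
    and "t powr (1 - p) * a powr p + (1 - t) powr (1 - p) * b powr p = L powr p \<Longrightarrow> a = t * L \<and> b = (1 - t) * L"
proof -
  define k where "k = p * L powr (p - 1)"
  have k: "k > 0" using assms by (simp add: k_def)
  have scale: "s * (c / s) powr p = s powr (1 - p) * c powr p" if "s > 0" "c \<ge> 0" for s c :: real
    using that by (simp add: powr_divide powr_diff)
  have R: "?R = t * (a / t) powr p + (1 - t) * (b / (1 - t)) powr p"
    using scale[of t a] scale[of "1 - t" b] assms by simp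
  have tangent: "L powr p + k * (x - L) \<le> x powr p" if "x \<ge> 0" for x
    using powr_strict_tangent[of p L x] that assms by (cases "x = L") (auto simp: k_def)
  \<comment> \<open>\<open>u\<close> and \<open>v\<close> are the weighted excesses over the tangent
    at \<open>L\<close>. The sum in question is \<open>L powr p\<close> plus three nonnegative
    terms, so in the equality case each of them vanishes.\<close>
  define u v where "u = t * ((a / t) powr p - (L powr p + k * (a / t - L)))"
    and "v = (1 - t) * ((b / (1 - t)) powr p - (L powr p + k * (b / (1 - t) - L)))"
  have uv: "u \<ge> 0" "v \<ge> 0"
    using assms tangent[of "a / t"] tangent[of "b / (1 - t)"] by (auto simp: u_def v_def)
  have e: "?R = L powr p + k * (a + b - L) + u + v"
  proof -
    have 1: "t * (a / t) = a" "(1 - t) * (b / (1 - t)) = b" using assms by auto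
    have "t * (L powr p + k * (a / t - L)) + (1 - t) * (L powr p + k * (b / (1 - t) - L))
      = L powr p + k * (t * (a / t) + (1 - t) * (b / (1 - t)) - L)"
      by (simp add: algebra_simps)
    then show ?thesis unfolding R u_def v_def 1 by (simp add: algebra_simps)
  qed
  have s: "k * (a + b - L) \<ge> 0" using k assms by simp
  show "L powr p \<le> ?R" using e uv s by linarith
  show "a = t * L \<and> b = (1 - t) * L" if "?R = L powr p"
  proof -
    have "u = 0" "v = 0" using that e uv s by linarith+
    then have "a / t = L" "b / (1 - t) = L"
      using powr_strict_tangent[of p L "a / t"] powr_strict_tangent[of p L "b / (1 - t)"] assms
      by (auto simp: u_def v_def k_def)
    then show ?thesis using assms by (auto simp: field_simps)
  qed
qed

text \<open>Segments are the only geodesics of an inner product space: Stewart's identity makes the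
  squared norm of \<open>(1 - t) *\<^sub>R (y - v) + t *\<^sub>R (y - w)\<close> zero.\<close>

lemma dist_eq_split_imp:
  fixes v w y :: "'a::real_inner"
  assumes "norm (y - v) = t * norm (v - w)" "norm (y - w) = (1 - t) * norm (v - w)"
    "0 \<le> t" "t \<le> 1"
  shows "y = (1 - t) *\<^sub>R v + t *\<^sub>R w"
proof -
  have "norm ((1 - t) *\<^sub>R (y - v) + t *\<^sub>R (y - w)) ^ 2
    = (1 - t) * norm (y - v) ^ 2 + t * norm (y - w) ^ 2 - t * (1 - t) * norm (v - w) ^ 2"
    unfolding power2_norm_eq_inner by (simp add: algebra_simps inner_commute power2_eq_square)
  also have "\<dots> = 0"
    unfolding assms by (simp add: power2_eq_square algebra_simps)
  finally have "(1 - t) *\<^sub>R (y - v) + t *\<^sub>R (y - w) = 0" by simp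
  then show ?thesis by (simp add: algebra_simps)
qed

section \<open>Weak duality\<close>

lemma optimal_cost_eq:
  assumes "\<mu> \<in> prob_measures_moment p" "\<nu> \<in> prob_measures_moment p" "p > 0"
  shows "(INF \<gamma>\<in>couplings \<mu> \<nu>. transport_cost p \<gamma>) = ennreal (wasserstein_dist p \<mu> \<nu> powr p)"
  using optimal_cost_finite[OF assms(1,2)] assms(3)
  by (simp add: wasserstein_dist_def powr_powr)

lemma AE_coupling:
  assumes "\<gamma> \<in> couplings \<mu> \<nu>" "AE x in \<mu>. P x" "AE y in \<nu>. Q y"
  shows "AE z in \<gamma>. P (fst z) \<and> Q (snd z)"
proof -
  note c = couplingsD[OF assms(1)]
  have [measurable_cong]: "sets \<gamma> = sets borel" by fact
  have "AE z in \<gamma>. P (fst z)"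
    by (rule AE_distrD[of fst \<gamma> borel]) (use c assms in auto)
  moreover have "AE z in \<gamma>. Q (snd z)"
    by (rule AE_distrD[of snd \<gamma> borel]) (use c assms in auto)
  ultimately show ?thesis by eventually_elim auto
qed

text \<open>The easy half of Kantorovich duality, by integrating the constraint against any
  coupling. The constraint is needed only where \<open>P\<close> and \<open>Q\<close> hold, so
  potentials can be adapted to measures carried by two atoms and the outside of a ball.\<close>

lemma wasserstein_weak_duality:
  assumes mu: "\<mu> \<in> prob_measures_moment p" and nu: "\<nu> \<in> prob_measures_moment p" and p: "p > 0"
    and \<phi>: "integrable \<mu> \<phi>" and \<psi>: "integrable \<nu> \<psi>"
    and A: "AE x in \<mu>. P x" and B: "AE y in \<nu>. Q y"
    and le: "\<And>x y. P x \<Longrightarrow> Q y \<Longrightarrow> \<phi> x + \<psi> y \<le> dist x y powr p"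
  shows "(\<integral>x. \<phi> x \<partial>\<mu>) + (\<integral>y. \<psi> y \<partial>\<nu>) \<le> wasserstein_dist p \<mu> \<nu> powr p"
proof -
  have "ennreal ((\<integral>x. \<phi> x \<partial>\<mu>) + (\<integral>y. \<psi> y \<partial>\<nu>)) \<le> transport_cost p \<gamma>"
    if g: "\<gamma> \<in> couplings \<mu> \<nu>" for \<gamma>
  proof (cases "transport_cost p \<gamma> = \<infinity>")
    case False
    note c = couplingsD[OF g]
    have [measurable_cong]: "sets \<gamma> = sets borel" by fact
    have [measurable]: "\<phi> \<in> borel_measurable borel" "\<psi> \<in> borel_measurable borel"
      using \<phi> \<psi> prob_measures_momentD[OF mu] prob_measures_momentD[OF nu]
      by (auto dest!: borel_measurable_integrable cong: measurable_cong_sets)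
    have i: "integrable \<gamma> (\<lambda>z. dist (fst z) (snd z) powr p)"
      using False unfolding integrable_iff_bounded transport_cost_def by (simp add: less_top)
    have i1: "integrable \<gamma> (\<lambda>z. \<phi> (fst z))"
      using \<phi> unfolding c(3)[symmetric] by (subst (asm) integrable_distr_eq) auto
    have i2: "integrable \<gamma> (\<lambda>z. \<psi> (snd z))"
      using \<psi> unfolding c(4)[symmetric] by (subst (asm) integrable_distr_eq) auto
    have "(\<integral>x. \<phi> x \<partial>\<mu>) + (\<integral>y. \<psi> y \<partial>\<nu>) = (\<integral>z. \<phi> (fst z) \<partial>\<gamma>) + (\<integral>z. \<psi> (snd z) \<partial>\<gamma>)"
      unfolding c(3,4)[symmetric] by (simp add: integral_distr)
    also have "\<dots> = (\<integral>z. \<phi> (fst z) + \<psi> (snd z) \<partial>\<gamma>)"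
      using i1 i2 by simp
    also have "\<dots> \<le> (\<integral>z. dist (fst z) (snd z) powr p \<partial>\<gamma>)"
    proof (rule integral_mono_AE)
      show "AE z in \<gamma>. \<phi> (fst z) + \<psi> (snd z) \<le> dist (fst z) (snd z) powr p"
        using AE_coupling[OF g A B] by eventually_elim (use le in auto)
    qed (use i i1 i2 in auto)
    finally have "ennreal ((\<integral>x. \<phi> x \<partial>\<mu>) + (\<integral>y. \<psi> y \<partial>\<nu>))
        \<le> ennreal (\<integral>z. dist (fst z) (snd z) powr p \<partial>\<gamma>)"
      by (rule ennreal_leI)
    also have "\<dots> = transport_cost p \<gamma>"
      unfolding transport_cost_def using i by (subst nn_integral_eq_integral) auto
    finally show ?thesis .
  qed simp
  then have "ennreal ((\<integral>x. \<phi> x \<partial>\<mu>) + (\<integral>y. \<psi> y \<partial>\<nu>)) \<le> ennreal (wasserstein_dist p \<mu> \<nu> powr p)"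
    unfolding optimal_cost_eq[OF mu nu p, symmetric] by (rule INF_greatest)
  then show ?thesis by simp
qed

section \<open>Potentials along a geodesic\<close>

text \<open>\<open>a\<close> is the distance from \<open>y\<close> to one of the places where
  \<open>\<rho> v\<close> has mass: \<open>v\<close>, \<open>- v\<close>, or the outside of the
  ball. A path from there through \<open>y\<close> to \<open>w\<close> has length at least
  \<open>L\<close>, and strictly more in the last two cases. Hence equality selects \<open>v\<close>
  and puts \<open>y\<close> on the segment.\<close>

lemma interpolation_distance_sum:
  fixes v w y :: "'a::euclidean_space"
  defines "L \<equiv> norm (v - w)"
  assumes t: "0 < t" "t < 1" and sep: "L < norm (v + w)" and far: "norm w + L < r"
    and a: "a \<in> {norm (y - v), norm (y + v), max 0 (r - norm y)}"
  shows "L \<le> a + norm (y - w)"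
    and "a = t * L \<Longrightarrow> norm (y - w) = (1 - t) * L \<Longrightarrow> y = (1 - t) *\<^sub>R v + t *\<^sub>R w"
proof -
  have 1: "L \<le> norm (y - v) + norm (y - w)"
    using norm_triangle_ineq4[of "y - v" "y - w"] by (simp add: L_def norm_minus_commute)
  have 2: "L < norm (y + v) + norm (y - w)"
    using norm_triangle_ineq4[of "y + v" "y - w"] sep by simp
  have 3: "L < max 0 (r - norm y) + norm (y - w)"
    using norm_triangle_ineq2[of y w] far by linarith
  show "L \<le> a + norm (y - w)" using a 1 2 3 by auto
  assume e: "a = t * L" "norm (y - w) = (1 - t) * L"
  then have "a + norm (y - w) = L" by (simp add: algebra_simps)
  with a 2 3 have "a = norm (y - v)" by auto
  with e t show "y = (1 - t) *\<^sub>R v + t *\<^sub>R w"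
    by (intro dist_eq_split_imp) (auto simp: L_def)
qed

text \<open>The two gap functions are dual potentials on the intermediate measure, for the transport from
  \<open>\<rho> v\<close> (after raising \<open>source_gap\<close> to the power \<open>p\<close>) and to \<open>\<rho> w\<close>.
  The constant \<open>A\<close> is the price of mass that is not sent to the atoms of \<open>\<rho> w\<close>; it shifts the
  second potential to make it nonnegative.\<close>

definition source_gap :: "real \<Rightarrow> 'a::euclidean_space \<Rightarrow> 'a \<Rightarrow> real" where
  "source_gap r v y = min (min (norm (y - v)) (norm (y + v))) (max 0 (r - norm y))"

definition target_gap :: "real \<Rightarrow> real \<Rightarrow> real \<Rightarrow> 'a::euclidean_space \<Rightarrow> 'a \<Rightarrow> real" where
  "target_gap p A r w y = min (min (norm (y - w) powr p) (norm (y + w) powr p)) (max 0 (r - norm y) powr p + A)"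

lemma source_gap_nonneg: "0 \<le> source_gap r v y"
  by (simp add: source_gap_def)

lemma source_gap_measurable [measurable]: "source_gap r v \<in> borel_measurable borel"
  unfolding source_gap_def[abs_def] by measurable

lemma target_gap_measurable [measurable]: "target_gap p A r w \<in> borel_measurable borel"
  unfolding target_gap_def[abs_def] by measurable

text \<open>Each value that the minimum in \<open>target_gap\<close> can take is treated separately:
  for \<open>w\<close> the claim is the scalar convexity inequality applied to the distance sum, and
  for \<open>- w\<close> the same after reflecting \<open>y\<close>. In the last case
  \<open>A\<close> alone contributes \<open>L powr p\<close>, so equality forces \<open>y\<close>
  out of the ball.\<close>

lemma interpolation_potentials:
  fixes v w y :: "'a::euclidean_space" and p t r :: real
  defines "L \<equiv> norm (v - w)"
  defines "h \<equiv> t powr (1 - p) * source_gap r v y powr p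
    + (1 - t) powr (1 - p) * target_gap p ((1 - t) powr (p - 1) * L powr p) r w y"
  assumes p: "1 < p" and t: "0 < t" "t < 1" and L: "0 < L" and sep: "L < norm (v + w)"
    and far: "norm w + L < r"
  shows "L powr p \<le> h"
    and "h = L powr p \<Longrightarrow>
      r \<le> norm y \<or> y = (1 - t) *\<^sub>R v + t *\<^sub>R w \<or> y = - ((1 - t) *\<^sub>R v + t *\<^sub>R w)"
proof -
  define a where "a = source_gap r v y"
  define A where "A = (1 - t) powr (p - 1) * L powr p"
  define B where "B = target_gap p A r w y"
  have a0: "a \<ge> 0" by (simp add: a_def source_gap_nonneg)
  have h: "h = t powr (1 - p) * a powr p + (1 - t) powr (1 - p) * B"
    by (simp add: h_def a_def A_def B_def)
  have a: "a \<in> {norm (y - v), norm (y + v), max 0 (r - norm y)}"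
    by (auto simp: a_def source_gap_def min_def)
  \<comment> \<open>Reflecting \<open>y\<close> only permutes the three candidates for the source
    gap.\<close>
  then have a': "a \<in> {norm (- y - v), norm (- y + v), max 0 (r - norm (- y))}"
    using norm_minus_cancel[of "y + v"] norm_minus_cancel[of "y - v"] by auto
  have "norm (- y - w) = norm (y + w)"
    using norm_minus_cancel[of "y + w"] by simp
  then consider "B = norm (y - w) powr p" | "B = norm (- y - w) powr p" | "B = max 0 (r - norm y) powr p + A"
    unfolding B_def target_gap_def min_def by metis
  then have "L powr p \<le> h \<and> (h = L powr p \<longrightarrow>
      r \<le> norm y \<or> y = (1 - t) *\<^sub>R v + t *\<^sub>R w \<or> y = - ((1 - t) *\<^sub>R v + t *\<^sub>R w))"
  proof cases
    case 1
    note d = interpolation_distance_sum[where v=v and w=w and y=y and a=a and t=t and r=r, folded L_def, OF t sep far a]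
    show ?thesis unfolding h 1
      using powr_convex_split[OF p L a0 norm_ge_zero t d(1)] d(2) by blast
  next
    case 2
    note d = interpolation_distance_sum[where v=v and w=w and y="-y" and a=a and t=t and r=r, folded L_def, OF t sep far a']
    show ?thesis unfolding h 2
      using powr_convex_split[OF p L a0 norm_ge_zero t d(1)] d(2) by (metis minus_minus)
  next
    case 3
    have "(1 - t) powr (1 - p) * A = L powr p"
      using t by (simp add: A_def powr_add[symmetric] mult.assoc[symmetric])
    then have "h = t powr (1 - p) * a powr p + (1 - t) powr (1 - p) * max 0 (r - norm y) powr p + L powr p"
      unfolding h 3 by (simp add: distrib_left)
    moreover have "0 \<le> t powr (1 - p) * a powr p" by simp
    moreover have "0 \<le> (1 - t) powr (1 - p) * max 0 (r - norm y) powr p" by simp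
    moreover have "0 < (1 - t) powr (1 - p) * max 0 (r - norm y) powr p" if "norm y < r"
      using that t by simp
    ultimately show ?thesis by (smt (verit))
  qed
  then show "L powr p \<le> h" "h = L powr p \<Longrightarrow>
      r \<le> norm y \<or> y = (1 - t) *\<^sub>R v + t *\<^sub>R w \<or> y = - ((1 - t) *\<^sub>R v + t *\<^sub>R w)"
    by blast+
qed

section \<open>Moving the atoms at a cost controlled by the dual slack\<close>

lemma powr_le_excess:
  fixes p c d :: real
  assumes "1 < p" "0 \<le> c" "c < d"
  obtains C where "0 \<le> C" "\<And>x. d \<le> x \<Longrightarrow> x powr p \<le> C * (x powr p - c powr p)"
proof -
  \<comment> \<open>The ratio of \<open>x powr p\<close> to its excess over \<open>c powr p\<close>
    decreases in \<open>x\<close>, so its value at \<open>d\<close> bounds it beyond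
    \<open>d\<close>.\<close>
  define C where "C = d powr p / (d powr p - c powr p)"
  have lt: "c powr p < d powr p" using assms by (intro powr_less_mono2) auto
  have "x powr p \<le> C * (x powr p - c powr p)" if "d \<le> x" for x
  proof -
    have "d powr p \<le> x powr p" using that assms by (intro powr_mono2) auto
    then have "c powr p * d powr p \<le> c powr p * x powr p" by (intro mult_left_mono) auto
    then have "x powr p * (d powr p - c powr p) \<le> d powr p * (x powr p - c powr p)"
      by (simp add: algebra_simps)
    then show ?thesis using lt by (simp add: C_def field_simps)
  qed
  moreover have "C \<ge> 0" using lt by (simp add: C_def)
  ultimately show ?thesis using that by blast
qed

definition move_atoms :: "'a::real_vector \<Rightarrow> 'a \<Rightarrow> 'a \<Rightarrow> 'a" where
  "move_atoms v m x = (if x = v then m else if x = - v then - m else x)"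

text \<open>Read as: the cost after moving the atoms is at most \<open>C\<close> times the slack
  \<open>dist x y powr p - source_gap r v y powr p\<close> of the dual constraint. A coupling with
  little slack therefore becomes nearly free. The slack is bounded below in each of the cases given
  by whether \<open>x\<close> and \<open>y\<close> are atoms or lie outside the ball.\<close>

lemma move_atoms_cost:
  fixes v m :: "'a::euclidean_space"
  assumes p: "1 < p" and sep: "norm (m - v) < norm (m + v)"
    and far: "2 * norm (m - v) + norm v < r"
  obtains C where "0 < C"
    "\<And>x y. r \<le> norm x \<or> x = v \<or> x = - v \<Longrightarrow> r \<le> norm y \<or> y = m \<or> y = - m \<Longrightarrow>
      dist (move_atoms v m x) y powr p + C * source_gap r v y powr p \<le> C * dist x y powr p"
proof -
  define d where "d = norm (m - v)"
  have d0: "0 \<le> d" by (simp add: d_def)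
  have md: "norm m \<le> norm v + d"
    using norm_triangle_ineq[of v "m - v"] by (simp add: d_def)
  have mlt: "d < r - norm m" using md far by (simp add: d_def)
  have vlt: "d < r - norm v" using far d0 unfolding d_def by linarith
  obtain C1 where C1: "0 \<le> C1" "\<And>x. r - norm m \<le> x \<Longrightarrow> x powr p \<le> C1 * (x powr p - d powr p)"
    using powr_le_excess[OF p d0 mlt] by blast
  obtain C2 where C2: "0 \<le> C2" "\<And>x. norm (m + v) \<le> x \<Longrightarrow> x powr p \<le> C2 * (x powr p - d powr p)"
    using powr_le_excess[OF p d0 sep[folded d_def]] by blast
  \<comment> \<open>An atom paired with the one of opposite sign is at distance
    \<open>norm (m + v)\<close> before the move and \<open>2 * norm m\<close> after it;
    \<open>R\<close> is the ratio of the costs.\<close>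
  define R where "R = (2 * norm m / norm (m + v)) powr p"
  \<comment> \<open>One summand for each case: \<open>C1\<close> for outside to atom,
    \<open>R * C2\<close> for atoms of opposite sign, \<open>2 powr p\<close> for atom to outside,
    and 1 for outside to outside.\<close>
  define C where "C = C1 + R * C2 + 2 powr p + 1"
  have C: "C1 \<le> C" "R * C2 \<le> C" "2 powr p \<le> C" "1 \<le> C"
    using C1(1) C2(1) by (auto simp: C_def R_def)
  have gap_K: "source_gap r v y = 0" if "r \<le> norm y" for y
    using that by (simp add: source_gap_def)
  have gap_m: "source_gap r v y \<le> d" if "y = m \<or> y = - m" for y
    using that norm_minus_cancel[of "m - v"] by (auto simp: source_gap_def d_def)
  have main: "dist (move_atoms v m x) y powr p + C * source_gap r v y powr p \<le> C * dist x y powr p"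
    if x: "r \<le> norm x \<or> x = v \<or> x = - v" and y: "r \<le> norm y \<or> y = m \<or> y = - m" for x y
  proof -
      have vx: "x \<noteq> v" "x \<noteq> - v" if "r \<le> norm x" using that vlt d0 by auto
    consider (KK) "r \<le> norm x" "r \<le> norm y" | (Km) "r \<le> norm x" "y = m \<or> y = - m"
      | (vK) "x = v \<or> x = - v" "r \<le> norm y" | (vm) "x = v \<or> x = - v" "y = m \<or> y = - m"
      using x y by blast
    then show ?thesis
    proof cases
      case KK
      then show ?thesis using vx C(4) p mult_right_mono[OF C(4), of "dist x y powr p"]
        by (simp add: move_atoms_def gap_K)
    next
      case Km
      have "norm y = norm m" using Km by auto
      then have ge: "r - norm m \<le> dist x y"
        using Km(1) norm_triangle_ineq2[of x y] by (simp add: dist_norm)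
      then have "d powr p \<le> dist x y powr p" using mlt d0 p by (intro powr_mono2) auto
      then have "dist x y powr p \<le> C * (dist x y powr p - d powr p)"
        using C1(2)[OF ge] C(1) by (meson diff_ge_0_iff_ge mult_right_mono order_trans)
      moreover have "C * source_gap r v y powr p \<le> C * d powr p"
        using gap_m[OF Km(2)] C(4) p by (intro mult_left_mono powr_mono2) (auto simp: source_gap_nonneg)
      ultimately show ?thesis using vx[OF Km(1)] by (simp add: move_atoms_def algebra_simps)
    next
      case vK
      \<comment> \<open>The outside is at least \<open>d\<close> away from the atom, so the
        displacement by at most \<open>d\<close> at most doubles the distance.\<close>
      have nx: "norm x = norm v" using vK by auto
      have "dist (move_atoms v m x) x \<le> d"
        using vK norm_minus_cancel[of "m - v"] by (auto simp: move_atoms_def dist_norm d_def)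
      moreover have "d \<le> dist x y"
        using vlt vK(2) nx norm_triangle_ineq2[of y x] by (simp add: dist_norm norm_minus_commute)
      ultimately have "dist (move_atoms v m x) y \<le> 2 * dist x y"
        using dist_triangle[of "move_atoms v m x" y x] by linarith
      then have "dist (move_atoms v m x) y powr p \<le> (2 * dist x y) powr p"
        using p by (intro powr_mono2) auto
      also have "\<dots> = 2 powr p * dist x y powr p" by (simp add: powr_mult)
      also have "\<dots> \<le> C * dist x y powr p" using C(3) by (intro mult_right_mono) auto
      finally show ?thesis using gap_K[OF vK(2)] p by simp
    next
      case vm
      have sign: "- v \<noteq> v" using sep by (metis add.right_neutral add_uminus_conv_diff less_irrefl)
      have gap: "C * source_gap r v y powr p \<le> C * d powr p"
        using gap_m[OF vm(2)] C(4) p by (intro mult_left_mono powr_mono2) (auto simp: source_gap_nonneg)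
      show ?thesis
      proof (cases "(x = v \<and> y = m) \<or> (x = - v \<and> y = - m)")
        case True
        then have "move_atoms v m x = y" using sign by (auto simp: move_atoms_def)
        moreover have "dist x y = d"
          using True norm_minus_cancel[of "m - v"] by (auto simp: d_def dist_norm norm_minus_commute)
        ultimately show ?thesis using gap p by simp
      next
        case False
        have "- v - m = - (m + v)" by simp
        then have "norm (- v - m) = norm (m + v)" by (simp only: norm_minus_cancel)
        then have "dist x y = norm (m + v)"
          using False vm by (auto simp: dist_norm add.commute)
        have "dist (move_atoms v m x) y = 2 * norm m"
        proof -
          have "dist (move_atoms v m x) y = norm (2 *\<^sub>R m)"
            using False vm sign norm_minus_cancel[of "2 *\<^sub>R m"]
            by (auto simp: move_atoms_def dist_norm scaleR_2 algebra_simps)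
          then show ?thesis by simp
        qed
        have pos: "0 < norm (m + v)" using sep norm_ge_zero[of "m - v"] by linarith
        have "dist (move_atoms v m x) y powr p = R * norm (m + v) powr p"
          unfolding \<open>dist (move_atoms v m x) y = 2 * norm m\<close> R_def
          using pos by (simp add: powr_mult[symmetric])
        also have "\<dots> \<le> R * (C2 * (norm (m + v) powr p - d powr p))"
          using C2(2)[of "norm (m + v)"] by (intro mult_left_mono) (auto simp: R_def)
        also have "\<dots> \<le> C * (norm (m + v) powr p - d powr p)"
        proof -
          have "d powr p \<le> norm (m + v) powr p"
            using sep p d0 by (intro powr_mono2) (auto simp: d_def)
          then show ?thesis using C(2) by (simp add: mult.assoc[symmetric] mult_right_mono)
        qed
        finally show ?thesis
          using gap \<open>dist x y = norm (m + v)\<close> by (simp add: algebra_simps)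
      qed
    qed
  qed
  show ?thesis by (rule that[OF _ main]) (use C(4) in auto)
qed

section \<open>Measures with a split atom\<close>

text \<open>All measures of the family are laws of random variables on one space. The joint law of
  two of them is then a coupling at once, and the only difference occurs on the events
  \<open>A\<close> and \<open>B\<close>.\<close>

locale split_atom = prob_space M for M :: "'w measure" +
  fixes Z :: "'w \<Rightarrow> 'a::euclidean_space" and A B :: "'w set" and p r e :: real
  assumes p: "1 < p" and r: "0 < r" and e: "0 < e"
    and Z_measurable [measurable]: "Z \<in> M \<rightarrow>\<^sub>M borel"
    and Z_moment: "integrable M (\<lambda>\<omega>. norm (Z \<omega>) powr p)"
    and Z_far: "r \<le> norm (Z \<omega>)"
    and A [measurable]: "A \<in> sets M" and B [measurable]: "B \<in> sets M"
    and disj: "A \<inter> B = {}"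
    and prob_A: "prob A = e / 2" and prob_B: "prob B = e / 2"
begin

definition Y :: "'a \<Rightarrow> 'w \<Rightarrow> 'a" where
  "Y v \<omega> = (if \<omega> \<in> A then v else if \<omega> \<in> B then - v else Z \<omega>)"

definition \<rho> :: "'a \<Rightarrow> 'a measure" where
  "\<rho> v = distr M borel (Y v)"

lemma Y_measurable [measurable]: "Y v \<in> M \<rightarrow>\<^sub>M borel"
  unfolding Y_def[abs_def] by measurable

lemma sets_rho [measurable_cong, simp]: "sets (\<rho> v) = sets borel"
  by (simp add: \<rho>_def)

lemma Y_cases: "r \<le> norm (Y v \<omega>) \<or> Y v \<omega> = v \<or> Y v \<omega> = - v"
  using Z_far by (auto simp: Y_def)

lemma AE_rho: "AE x in \<rho> v. r \<le> norm x \<or> x = v \<or> x = - v"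
  unfolding \<rho>_def using Y_cases by (subst AE_distr_iff) auto

lemma prob_atoms: "prob (A \<union> B) = e"
  using finite_measure_Union[OF A B disj] prob_A prob_B by simp

lemma rho_in_moment: "\<rho> v \<in> prob_measures_moment p"
proof -
  have "integrable M (\<lambda>\<omega>. norm (Y v \<omega>) powr p)"
  proof (rule Bochner_Integration.integrable_bound)
    show "integrable M (\<lambda>\<omega>. norm (Z \<omega>) powr p + norm v powr p)"
      using Z_moment by simp
    show "AE \<omega> in M. norm (norm (Y v \<omega>) powr p) \<le> norm (norm (Z \<omega>) powr p + norm v powr p)"
      by (intro AE_I2) (auto simp: Y_def)
  qed measurable
  then show ?thesis
    unfolding prob_measures_moment_def \<rho>_def
    by (auto intro!: prob_space_distr simp: integrable_distr_eq)
qed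

lemma integral_rho_atoms:
  fixes \<phi> :: "'a \<Rightarrow> real"
  assumes [measurable]: "\<phi> \<in> borel_measurable borel"
    and v: "\<phi> v = c" "\<phi> (- v) = c" and far: "\<And>x. r \<le> norm x \<Longrightarrow> \<phi> x = k"
  shows "integrable (\<rho> v) \<phi>" "(\<integral>x. \<phi> x \<partial>\<rho> v) = k + (c - k) * e"
proof -
  have eq: "\<phi> (Y v \<omega>) = k + (c - k) * indicator (A \<union> B) \<omega>" for \<omega>
    using v far[OF Z_far] by (auto simp: Y_def indicator_def)
  have "integrable M (indicator (A \<union> B) :: 'w \<Rightarrow> real)"
    by (intro integrable_real_indicator) (auto simp: less_top[symmetric])
  then show "integrable (\<rho> v) \<phi>"
    unfolding \<rho>_def by (subst integrable_distr_eq) (auto simp: eq)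
  show "(\<integral>x. \<phi> x \<partial>\<rho> v) = k + (c - k) * e"
    unfolding \<rho>_def using \<open>integrable M (indicator (A \<union> B))\<close>
    by (subst integral_distr) (auto simp: eq prob_space prob_atoms sets.Int_space_eq2)
qed

text \<open>\<open>A\<close> and \<open>B\<close> have equal probability, so exchanging the two
  atoms does not change the law. This is the identification of \<open>v\<close> with
  \<open>- v\<close> in the cone.\<close>

lemma rho_minus: "\<rho> (- v) = \<rho> v"
proof (rule measure_eqI)
  fix X assume "X \<in> sets (\<rho> (- v))"
  then have [measurable]: "X \<in> sets borel" by simp
  have "emeasure (\<rho> u) X = emeasure M (Z -` X \<inter> (space M - A - B)) + (ennreal (e / 2) * indicator X u + ennreal (e / 2) * indicator X (- u))" for u
  proof -
    have "emeasure (\<rho> u) X = (\<integral>\<^sup>+x. indicator X x \<partial>\<rho> u)" by simp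
    also have "\<dots> = (\<integral>\<^sup>+\<omega>. indicator X (Y u \<omega>) \<partial>M)"
      unfolding \<rho>_def by (subst nn_integral_distr) auto
    also have "\<dots> = (\<integral>\<^sup>+\<omega>. indicator (Z -` X \<inter> space M \<inter> (space M - A - B)) \<omega> + (indicator X u * indicator A \<omega> + indicator X (- u) * indicator B \<omega>) \<partial>M)"
      using disj by (intro nn_integral_cong) (auto simp: Y_def indicator_def)
    also have "\<dots> = emeasure M (Z -` X \<inter> space M \<inter> (space M - A - B)) + (indicator X u * emeasure M A + indicator X (- u) * emeasure M B)"
      by (simp add: nn_integral_add nn_integral_cmult)
    finally show ?thesis
      by (simp add: emeasure_eq_measure prob_A prob_B mult.commute Int_absorb1 Int_assoc)
  qed
  from this[of v] this[of "- v"] show "emeasure (\<rho> (- v)) X = emeasure (\<rho> v) X"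
    by (simp add: add.commute)
qed simp

lemma wasserstein_rho_le: "wasserstein_dist p (\<rho> v) (\<rho> w) powr p \<le> e * norm (v - w) powr p"
proof -
  have p0: "p > 0" using p by simp
  let ?\<gamma> = "distr M borel (\<lambda>\<omega>. (Y v \<omega>, Y w \<omega>))"
  have g: "?\<gamma> \<in> couplings (\<rho> v) (\<rho> w)"
    by (rule couplings_distrI) (auto simp: \<rho>_def prob_space_axioms)
  have "ennreal (wasserstein_dist p (\<rho> v) (\<rho> w) powr p) \<le> transport_cost p ?\<gamma>"
    unfolding optimal_cost_eq[OF rho_in_moment rho_in_moment p0, symmetric]
    by (rule INF_lower[OF g])
  also have "\<dots> = (\<integral>\<^sup>+\<omega>. ennreal (norm (v - w) powr p) * indicator (A \<union> B) \<omega> \<partial>M)"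
    unfolding transport_cost_distr[OF Y_measurable Y_measurable]
    using norm_minus_cancel[of "v - w"]
    by (intro nn_integral_cong) (auto simp: Y_def indicator_def dist_norm)
  also have "\<dots> = ennreal (norm (v - w) powr p) * ennreal e"
    by (simp add: nn_integral_cmult emeasure_eq_measure prob_atoms)
  also have "\<dots> = ennreal (e * norm (v - w) powr p)"
    using e by (simp add: ennreal_mult[symmetric] mult.commute)
  finally show ?thesis using e by simp
qed

text \<open>The upper bound is the coupling on the common space. For the lower bound, the mass
  \<open>e\<close> at the atoms of \<open>\<rho> w\<close> is at distance at least
  \<open>norm (v - w)\<close> from all mass of \<open>\<rho> v\<close>: from the atoms by
  \<open>sep\<close>, from the rest by \<open>far\<close>. The potential \<open>\<psi>\<close>
  charges just these atoms.\<close>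

lemma wasserstein_rho:
  assumes far: "norm w + norm (v - w) \<le> r" "norm w < r"
    and sep: "norm (v - w) \<le> norm (v + w)"
  shows "wasserstein_dist p (\<rho> v) (\<rho> w) = e powr (1 / p) * norm (v - w)"
proof -
  have p0: "p > 0" using p by simp
  define L where "L = norm (v - w)"
  define \<psi> where "\<psi> y = (if y = w \<or> y = - w then L powr p else 0)" for y :: 'a
  have \<psi>_meas: "\<psi> \<in> borel_measurable borel" unfolding \<psi>_def[abs_def] by measurable
  have "\<psi> w = L powr p" "\<psi> (- w) = L powr p" "\<And>x. r \<le> norm x \<Longrightarrow> \<psi> x = 0"
    using far(2) by (auto simp: \<psi>_def)
  note \<psi> = integral_rho_atoms[OF \<psi>_meas this]
  have "(\<integral>x. 0 \<partial>\<rho> v) + (\<integral>y. \<psi> y \<partial>\<rho> w) \<le> wasserstein_dist p (\<rho> v) (\<rho> w) powr p"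
  proof (rule wasserstein_weak_duality[OF rho_in_moment rho_in_moment p0 _ \<psi>(1) AE_rho AE_rho])
    fix x y assume x: "r \<le> norm x \<or> x = v \<or> x = - v" and y: "r \<le> norm y \<or> y = w \<or> y = - w"
    have "- v - w = - (v + w)" by simp
    then have "norm (- v - w) = norm (v + w)" by (simp only: norm_minus_cancel)
    then have "L \<le> dist x y" if "y = w \<or> y = - w"
      using x that far(1) sep norm_triangle_ineq2[of x y]
      by (auto simp: L_def dist_norm norm_minus_commute)
    then show "0 + \<psi> y \<le> dist x y powr p"
      using p by (auto simp: \<psi>_def L_def intro!: powr_mono2)
  qed simp
  then have "e * L powr p \<le> wasserstein_dist p (\<rho> v) (\<rho> w) powr p"
    by (simp add: \<psi>(2) mult.commute)
  with wasserstein_rho_le[of v w] have "wasserstein_dist p (\<rho> v) (\<rho> w) powr p = e * L powr p"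
    by (simp add: L_def)
  then have "(wasserstein_dist p (\<rho> v) (\<rho> w) powr p) powr (1 / p) = e powr (1 / p) * L"
    using e p by (simp add: powr_mult powr_powr L_def)
  then show ?thesis
    using p by (simp add: powr_powr L_def wasserstein_dist_def)
qed

text \<open>Moving the atoms of the first marginal from \<open>v\<close>, \<open>- v\<close> to \<open>m\<close>, \<open>- m\<close> turns an almost optimal coupling of
  \<open>\<rho> v\<close> and \<open>\<nu>\<close> into a coupling of \<open>\<rho> m\<close> and \<open>\<nu>\<close> of almost zero cost.\<close>

lemma eq_rho_if_source_gap_optimal:
  assumes \<nu>: "\<nu> \<in> prob_measures_moment p"
    and m: "AE y in \<nu>. r \<le> norm y \<or> y = m \<or> y = - m"
    and sep: "norm (m - v) < norm (m + v)" and far: "2 * norm (m - v) + norm v < r"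
    and opt: "wasserstein_dist p (\<rho> v) \<nu> powr p \<le> (\<integral>y. source_gap r v y powr p \<partial>\<nu>)"
    and int: "integrable \<nu> (\<lambda>y. source_gap r v y powr p)"
  shows "\<nu> = \<rho> m"
proof -
  have p0: "p > 0" using p by simp
  define a where "a = (\<integral>y. source_gap r v y powr p \<partial>\<nu>)"
  have a0: "a \<ge> 0" unfolding a_def by simp
  have snu [measurable_cong]: "sets \<nu> = sets borel" using prob_measures_momentD[OF \<nu>] by simp
  obtain C where C: "0 < C" "\<And>x y. r \<le> norm x \<or> x = v \<or> x = - v \<Longrightarrow> r \<le> norm y \<or> y = m \<or> y = - m \<Longrightarrow>
      dist (move_atoms v m x) y powr p + C * source_gap r v y powr p \<le> C * dist x y powr p"
    by (rule move_atoms_cost[OF p sep far]) (rule that)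
  have [measurable]: "move_atoms v m \<in> borel_measurable borel"
    unfolding move_atoms_def[abs_def] by measurable
  have sign: "- v \<noteq> v" using sep by (metis add.right_neutral add_uminus_conv_diff less_irrefl)
  have vr: "norm v < r" using far norm_ge_zero[of "m - v"] by linarith
  have move_Y: "move_atoms v m (Y v \<omega>) = Y m \<omega>" for \<omega>
  proof -
    have "Z \<omega> \<noteq> v" "Z \<omega> \<noteq> - v" using vr Z_far[of \<omega>] by auto
    then show ?thesis using sign by (auto simp: move_atoms_def Y_def)
  qed
  define W where "W = wasserstein_dist p (\<rho> m) \<nu> powr p"
  have W0: "W \<ge> 0" by (simp add: W_def)
  \<comment> \<open>Every coupling of \<open>\<rho> v\<close> and \<open>\<nu>\<close> costs at
    least \<open>a + W / C\<close>. The infimum is at most \<open>a\<close> by \<open>opt\<close>,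
    which forces \<open>W = 0\<close>.\<close>
  have "ennreal ((W + C * a) / C) \<le> transport_cost p \<gamma>" if g: "\<gamma> \<in> couplings (\<rho> v) \<nu>" for \<gamma>
  proof (cases "transport_cost p \<gamma>")
    case (real c)
    note c = couplingsD[OF g]
    have [measurable_cong]: "sets \<gamma> = sets borel" by fact
    have "distr \<gamma> borel (\<lambda>z. move_atoms v m (fst z)) = distr (distr \<gamma> borel fst) borel (move_atoms v m)"
      by (subst distr_distr) (auto simp: comp_def)
    also have "\<dots> = \<rho> m"
      unfolding c(3) \<rho>_def by (subst distr_distr) (auto simp: comp_def move_Y)
    finally have "distr \<gamma> borel (\<lambda>z. (move_atoms v m (fst z), snd z)) \<in> couplings (\<rho> m) \<nu>"
      using c(1,4) by (intro couplings_distrI) auto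
    then have "ennreal W \<le> transport_cost p (distr \<gamma> borel (\<lambda>z. (move_atoms v m (fst z), snd z)))"
      unfolding W_def optimal_cost_eq[OF rho_in_moment \<nu> p0, symmetric] by (rule INF_lower)
    also have "\<dots> = (\<integral>\<^sup>+z. ennreal (dist (move_atoms v m (fst z)) (snd z) powr p) \<partial>\<gamma>)"
      by (rule transport_cost_distr) auto
    finally have 1: "ennreal W \<le> \<dots>" .
    have "(\<integral>\<^sup>+z. ennreal (C * source_gap r v (snd z) powr p) \<partial>\<gamma>) = (\<integral>\<^sup>+y. ennreal (C * source_gap r v y powr p) \<partial>\<nu>)"
      unfolding c(4)[symmetric] by (subst nn_integral_distr) auto
    also have "\<dots> = ennreal (C * a)"
      unfolding a_def using int C(1) by (subst nn_integral_eq_integral) auto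
    finally have 2: "(\<integral>\<^sup>+z. ennreal (C * source_gap r v (snd z) powr p) \<partial>\<gamma>) = ennreal (C * a)" .
    have "ennreal (W + C * a) = ennreal W + ennreal (C * a)"
      using W0 C(1) a0 by simp
    also have "\<dots> \<le> (\<integral>\<^sup>+z. ennreal (dist (move_atoms v m (fst z)) (snd z) powr p) \<partial>\<gamma>)
        + (\<integral>\<^sup>+z. ennreal (C * source_gap r v (snd z) powr p) \<partial>\<gamma>)"
      unfolding 2 using 1 by (rule add_right_mono)
    also have "\<dots> = (\<integral>\<^sup>+z. ennreal (dist (move_atoms v m (fst z)) (snd z) powr p) + ennreal (C * source_gap r v (snd z) powr p) \<partial>\<gamma>)"
      by (rule nn_integral_add[symmetric]) auto
    also have "\<dots> \<le> (\<integral>\<^sup>+z. ennreal C * ennreal (dist (fst z) (snd z) powr p) \<partial>\<gamma>)"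
    proof (rule nn_integral_mono_AE, use AE_coupling[OF g AE_rho m] in eventually_elim)
      fix z assume "(r \<le> norm (fst z) \<or> fst z = v \<or> fst z = - v) \<and> (r \<le> norm (snd z) \<or> snd z = m \<or> snd z = - m)"
      then show "ennreal (dist (move_atoms v m (fst z)) (snd z) powr p) + ennreal (C * source_gap r v (snd z) powr p)
          \<le> ennreal C * ennreal (dist (fst z) (snd z) powr p)"
        using C(1) C(2)[of "fst z" "snd z"]
        by (simp add: ennreal_mult[symmetric] ennreal_plus[symmetric] ennreal_leI del: ennreal_plus)
    qed
    also have "\<dots> = ennreal C * transport_cost p \<gamma>"
      unfolding transport_cost_def by (rule nn_integral_cmult) auto
    also have "\<dots> = ennreal (C * c)"
      using real C(1) by (simp add: ennreal_mult)
    finally have "W + C * a \<le> C * c"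
      using real C(1) by (subst (asm) ennreal_le_iff) auto
    then have "(W + C * a) / C \<le> c" using C(1) by (simp add: field_simps)
    then show ?thesis unfolding real by (rule ennreal_leI)
  qed simp
  then have "ennreal ((W + C * a) / C) \<le> ennreal (wasserstein_dist p (\<rho> v) \<nu> powr p)"
    unfolding optimal_cost_eq[OF rho_in_moment \<nu> p0, symmetric] by (rule INF_greatest)
  also have "\<dots> \<le> ennreal a" using opt unfolding a_def by (rule ennreal_leI)
  finally have "(W + C * a) / C \<le> a" using a0 by simp
  then have "W = 0" using C(1) W0 by (simp add: field_simps)
  then have "wasserstein_dist p (\<rho> m) \<nu> = 0" by (simp add: W_def)
  then show ?thesis using wasserstein_zero_imp_eq[OF rho_in_moment \<nu> p0] by metis
qed

text \<open>Uniqueness of the intermediate points. The potentials bound the integral of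
  \<open>h\<close> from above by \<open>L powr p\<close>, which is also a pointwise lower bound of
  \<open>h\<close>; so \<open>h\<close> is constant almost everywhere and both dual bounds are
  attained.\<close>

lemma rho_between:
  assumes \<nu>: "\<nu> \<in> prob_measures_moment p" and t: "0 < t" "t < 1" and vw: "v \<noteq> w"
    and sep: "norm (v - w) < norm (v + w)"
    and far: "norm v + 2 * norm (v - w) < r" "norm w + 2 * norm (v - w) < r"
    and d1: "wasserstein_dist p (\<rho> v) \<nu> = t * wasserstein_dist p (\<rho> v) (\<rho> w)"
    and d2: "wasserstein_dist p \<nu> (\<rho> w) = (1 - t) * wasserstein_dist p (\<rho> v) (\<rho> w)"
  shows "\<nu> = \<rho> ((1 - t) *\<^sub>R v + t *\<^sub>R w)"
proof -
  define m where "m = (1 - t) *\<^sub>R v + t *\<^sub>R w"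
  define L where "L = norm (v - w)"
  have L: "L > 0" using vw by (simp add: L_def)
  have p0: "p > 0" using p by simp
  note n = prob_measures_momentD[OF \<nu>]
  interpret N: prob_space \<nu> by fact
  have snu [measurable_cong]: "sets \<nu> = sets borel" by fact
  have wr: "norm w < r" "norm w + L < r" using far(2) L unfolding L_def by linarith+
  have D: "wasserstein_dist p (\<rho> v) (\<rho> w) powr p = e * L powr p"
    using wasserstein_rho[of w v] wr sep e p by (simp add: L_def powr_mult powr_powr)
  \<comment> \<open>The constant of \<open>interpolation_potentials\<close>, for which
    \<open>(1 - t) powr (1 - p) * K = L powr p\<close>.\<close>
  define K where "K = (1 - t) powr (p - 1) * L powr p"
  define f where "f y = source_gap r v y powr p" for y
  define g where "g y = target_gap p K r w y" for y
  have [measurable]: "f \<in> borel_measurable borel" "g \<in> borel_measurable borel"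
    unfolding f_def[abs_def] g_def[abs_def] by measurable
  have K0: "K \<ge> 0" by (simp add: K_def)
  have f_int: "integrable \<nu> f"
  proof (rule N.integrable_const_bound)
    have "max 0 (r - norm y) \<le> r" for y :: 'a using r norm_ge_zero[of y] by simp
    then have "source_gap r v y \<le> r" for y by (simp add: source_gap_def min.coboundedI2)
    then show "AE y in \<nu>. norm (f y) \<le> r powr p"
      using p by (auto simp: f_def source_gap_nonneg intro!: AE_I2 powr_mono2)
  qed measurable
  have g_int: "integrable \<nu> g"
  proof (rule N.integrable_const_bound)
    have "g y \<le> r powr p + K" for y
    proof -
      have "max 0 (r - norm y) powr p \<le> r powr p" using r p by (intro powr_mono2) auto
      then show ?thesis by (simp add: g_def target_gap_def)
    qed
    moreover have "0 \<le> g y" for y using K0 by (simp add: g_def target_gap_def)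
    ultimately show "AE y in \<nu>. norm (g y) \<le> r powr p + K" by (intro AE_I2) simp
  qed measurable
  have W1: "wasserstein_dist p (\<rho> v) \<nu> powr p = t powr p * (e * L powr p)"
    unfolding d1 using t D by (simp add: powr_mult wasserstein_dist_def)
  have W2: "wasserstein_dist p \<nu> (\<rho> w) powr p = (1 - t) powr p * (e * L powr p)"
    unfolding d2 using t D by (simp add: powr_mult wasserstein_dist_def)
  have "(\<integral>x. 0 \<partial>\<rho> v) + (\<integral>y. f y \<partial>\<nu>) \<le> wasserstein_dist p (\<rho> v) \<nu> powr p"
  proof (rule wasserstein_weak_duality[where Q="\<lambda>_. True", OF rho_in_moment \<nu> p0 _ f_int AE_rho])
    fix x y assume x: "r \<le> norm x \<or> x = v \<or> x = - v"
    have "source_gap r v y \<le> dist x y"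
      using x norm_triangle_ineq2[of x y]
      by (auto simp: source_gap_def dist_norm norm_minus_commute min_le_iff_disj add.commute)
    then show "0 + f y \<le> dist x y powr p"
      using p by (auto simp: f_def source_gap_nonneg intro!: powr_mono2)
  qed auto
  then have If: "(\<integral>y. f y \<partial>\<nu>) \<le> t powr p * (e * L powr p)" using W1 by simp
  \<comment> \<open>The shift by \<open>K\<close> in \<open>g\<close> is undone away from the atoms
    of \<open>\<rho> w\<close>; over the mass \<open>1 - e\<close> there it costs
    \<open>K * (1 - e)\<close>.\<close>
  define \<psi> where "\<psi> z = (if z = w \<or> z = - w then 0 else - K)" for z :: 'a
  have \<psi>_meas: "\<psi> \<in> borel_measurable borel" unfolding \<psi>_def[abs_def] by measurable
  have "\<psi> w = 0" "\<psi> (- w) = 0" "\<And>x. r \<le> norm x \<Longrightarrow> \<psi> x = - K"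
    using wr(1) by (auto simp: \<psi>_def)
  note \<psi> = integral_rho_atoms[OF \<psi>_meas this]
  have "(\<integral>y. g y \<partial>\<nu>) + (\<integral>z. \<psi> z \<partial>\<rho> w) \<le> wasserstein_dist p \<nu> (\<rho> w) powr p"
  proof (rule wasserstein_weak_duality[where P="\<lambda>_. True", OF \<nu> rho_in_moment p0 g_int \<psi>(1) _ AE_rho])
    fix y z assume z: "r \<le> norm z \<or> z = w \<or> z = - w"
    show "g y + \<psi> z \<le> dist y z powr p"
    proof (cases "z = w \<or> z = - w")
      case True
      then show ?thesis by (auto simp: g_def target_gap_def \<psi>_def dist_norm)
    next
      case False
      then have "max 0 (r - norm y) \<le> dist y z"
        using z norm_triangle_ineq2[of z y] by (auto simp: dist_norm norm_minus_commute)
      then have "max 0 (r - norm y) powr p \<le> dist y z powr p" using p by (intro powr_mono2) auto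
      then show ?thesis using False by (simp add: g_def target_gap_def \<psi>_def)
    qed
  qed auto
  then have Ig: "(\<integral>y. g y \<partial>\<nu>) \<le> (1 - t) powr p * (e * L powr p) + K * (1 - e)"
    using W2 \<psi>(2) by (simp add: algebra_simps)
  define h where "h y = t powr (1 - p) * f y + (1 - t) powr (1 - p) * g y" for y
  have h_ge: "L powr p \<le> h y"
    and h_eq: "h y = L powr p \<Longrightarrow> r \<le> norm y \<or> y = m \<or> y = - m" for y
    using interpolation_potentials[OF p t L[unfolded L_def] sep wr(2)[unfolded L_def], of y]
    by (simp_all add: h_def f_def g_def K_def L_def m_def)
  have h_int: "integrable \<nu> h" unfolding h_def[abs_def] using f_int g_int by simp
  have Ih: "(\<integral>y. h y \<partial>\<nu>) = t powr (1 - p) * (\<integral>y. f y \<partial>\<nu>) + (1 - t) powr (1 - p) * (\<integral>y. g y \<partial>\<nu>)"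
    unfolding h_def using f_int g_int by simp
  have t1: "t powr (1 - p) * t powr p = t" using t by (simp add: powr_add[symmetric])
  have t2: "(1 - t) powr (1 - p) * (1 - t) powr p = 1 - t" using t by (simp add: powr_add[symmetric])
  have t3: "(1 - t) powr (1 - p) * (1 - t) powr (p - 1) = 1" using t by (simp add: powr_add[symmetric])
  \<comment> \<open>The second half accounts for at most the share \<open>1 - t * e\<close> of
    \<open>L powr p\<close> and the first, in \<open>bf\<close>, for at most \<open>t * e\<close>;
    together they leave no room above the lower bound.\<close>
  have bg: "(1 - t) powr (1 - p) * (\<integral>y. g y \<partial>\<nu>) \<le> (1 - t * e) * L powr p"
  proof -
    have "(1 - t) powr (1 - p) * (\<integral>y. g y \<partial>\<nu>)
      \<le> (1 - t) powr (1 - p) * ((1 - t) powr p * (e * L powr p) + K * (1 - e))"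
      using Ig by (intro mult_left_mono) auto
    also have "\<dots> = ((1 - t) powr (1 - p) * (1 - t) powr p) * (e * L powr p)
        + ((1 - t) powr (1 - p) * (1 - t) powr (p - 1)) * L powr p * (1 - e)"
      by (simp add: K_def algebra_simps)
    also have "\<dots> = (1 - t * e) * L powr p" unfolding t2 t3 by (simp add: algebra_simps)
    finally show ?thesis .
  qed
  have bf: "t powr (1 - p) * (\<integral>y. f y \<partial>\<nu>) \<le> t * e * L powr p"
  proof -
    have "t powr (1 - p) * (\<integral>y. f y \<partial>\<nu>) \<le> t powr (1 - p) * (t powr p * (e * L powr p))"
      using If by (intro mult_left_mono) auto
    also have "\<dots> = (t powr (1 - p) * t powr p) * (e * L powr p)" by (simp only: mult.assoc)
    finally show ?thesis unfolding t1 by (simp only: mult.assoc)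
  qed
  have lower: "L powr p \<le> (\<integral>y. h y \<partial>\<nu>)"
    using integral_mono[of \<nu> "\<lambda>_. L powr p" h] h_int h_ge N.prob_space by simp
  have I0: "(\<integral>y. h y - L powr p \<partial>\<nu>) = 0"
    using lower bf bg Ih h_int N.prob_space by (simp add: algebra_simps)
  have "AE y in \<nu>. h y - L powr p = 0"
    using I0 h_int h_ge by (subst (asm) integral_nonneg_eq_0_iff_AE) auto
  then have conc: "AE y in \<nu>. r \<le> norm y \<or> y = m \<or> y = - m"
    by eventually_elim (use h_eq in auto)
  \<comment> \<open>As the second half cannot exceed its share, the first must reach its own:
    \<open>f\<close> is an optimal potential between \<open>\<rho> v\<close> and
    \<open>\<nu>\<close>.\<close>
  have "t * (e * L powr p) \<le> t powr (1 - p) * (\<integral>y. f y \<partial>\<nu>)"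
    using lower bg Ih by (simp add: algebra_simps)
  then have "t powr p * (e * L powr p) \<le> (\<integral>y. f y \<partial>\<nu>)"
    using t t1 by (metis (no_types, opaque_lifting) mult.assoc mult_le_cancel_left_pos powr_gt_zero less_irrefl)
  then have opt: "wasserstein_dist p (\<rho> v) \<nu> powr p \<le> (\<integral>y. source_gap r v y powr p \<partial>\<nu>)"
    by (simp add: W1 f_def)
  have mv: "norm (m - v) = t * L"
  proof -
    have "m - v = t *\<^sub>R (w - v)" by (simp add: m_def algebra_simps)
    then show ?thesis using t by (simp add: L_def norm_minus_commute)
  qed
  \<comment> \<open>If \<open>m\<close> were within \<open>t * L\<close> of \<open>- v\<close>,
    continuing from \<open>m\<close> to \<open>w\<close> would bring \<open>w\<close> within
    \<open>L\<close> of \<open>- v\<close>, against \<open>sep\<close>.\<close>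
  have "norm (m + v) > t * L"
  proof -
    have eq: "v + w = (m + v) + (1 - t) *\<^sub>R (w - v)" by (simp add: m_def algebra_simps)
    have "norm (v + w) \<le> norm (m + v) + norm ((1 - t) *\<^sub>R (w - v))"
      unfolding eq by (rule norm_triangle_ineq)
    also have "norm ((1 - t) *\<^sub>R (w - v)) = (1 - t) * L"
      using t by (simp add: L_def norm_minus_commute)
    finally show ?thesis using sep by (simp add: L_def algebra_simps)
  qed
  moreover have "2 * (t * L) + norm v < r"
    using far(1) mult_right_mono[of t 1 L] t L unfolding L_def by linarith
  ultimately have "\<nu> = \<rho> m"
    using eq_rho_if_source_gap_optimal[OF \<nu> conc _ _ opt f_int[unfolded f_def]] mv by simp
  then show ?thesis by (simp add: m_def)
qed

end

section \<open>Density of measures with a split atom\<close>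

text \<open>Points of the ball are pushed to its boundary at distance at most \<open>2 * r\<close>,
  and an independently chosen fraction \<open>e\<close> of all mass is sent to the atoms.
  Independence makes the cost of the latter \<open>e * J\<close>, whatever \<open>\<mu>\<close>
  is.\<close>

lemma split_atom_near:
  fixes \<mu> :: "'a::euclidean_space measure"
  assumes \<mu>: "\<mu> \<in> prob_measures_moment p" and p: "1 < p" and \<eta>: "0 < \<eta>"
  obtains M :: "('a \<times> bool \<times> bool) measure" and Z A B r e
  where "split_atom M Z A B p r e"
    "\<And>v. norm v \<le> r \<Longrightarrow> wasserstein_dist p \<mu> (split_atom.\<rho> M Z A B v) < \<eta>"
proof -
  note m = prob_measures_momentD[OF \<mu>]
  interpret N: prob_space \<mu> by fact
  have [measurable_cong]: "sets \<mu> = sets borel" by fact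
  have p0: "p > 0" using p by simp
  \<comment> \<open>The final bound on the distance is \<open>4 * r\<close>, half of
    \<open>\<eta>\<close>.\<close>
  define r where "r = \<eta> / 8"
  have r: "r > 0" using \<eta> by (simp add: r_def)
  obtain b :: 'a where "b \<in> Basis" using nonempty_Basis by blast
  then have nb: "norm (r *\<^sub>R b) = r" using r by simp
  define J where "J = enn2real (\<integral>\<^sup>+x. ennreal ((norm x + r) powr p) \<partial>\<mu>)"
  have J0: "J \<ge> 0" by (simp add: J_def)
  have J: "(\<integral>\<^sup>+x. ennreal ((norm x + r) powr p) \<partial>\<mu>) = ennreal J"
  proof -
    have "(norm x + r) powr p \<le> 2 powr p * norm x powr p + 2 powr p * r powr p" for x :: 'a
    proof -
      have "(norm x + r) powr p \<le> (2 * max (norm x) r) powr p"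
        using p r by (intro powr_mono2) auto
      also have "\<dots> = 2 powr p * max (norm x) r powr p"
        using r by (simp add: powr_mult)
      also have "\<dots> \<le> 2 powr p * (norm x powr p + r powr p)"
        by (intro mult_left_mono) (auto simp: max_def)
      finally show ?thesis by (simp add: distrib_left)
    qed
    then have "integrable \<mu> (\<lambda>x. (norm x + r) powr p)"
      using m(3) by (intro Bochner_Integration.integrable_bound[where f="\<lambda>x. 2 powr p * norm x powr p + 2 powr p * r powr p" and g="\<lambda>x. (norm x + r) powr p"]) auto
    then show ?thesis
      unfolding J_def integrable_iff_bounded by (simp add: less_top)
  qed
  \<comment> \<open>The bound \<open>1 / 2\<close> keeps \<open>e\<close> a valid probability, the
    other one makes \<open>e * J\<close> at most \<open>(2 * r) powr p\<close>; \<open>J + 1\<close>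
    avoids division by zero.\<close>
  define e where "e = min (1 / 2) ((2 * r) powr p / (J + 1))"
  have e: "0 < e" "e < 1" using r J0 by (auto simp: e_def min_def)
  have eJ: "e * J \<le> (2 * r) powr p"
  proof -
    have "e * J \<le> (2 * r) powr p / (J + 1) * J" using J0 by (intro mult_right_mono) (auto simp: e_def)
    also have "\<dots> \<le> (2 * r) powr p" using J0 by (simp add: field_simps)
    finally show ?thesis .
  qed
  \<comment> \<open>Two independent coins: the first decides whether a point is sent to the atoms,
    the second chooses the sign.\<close>
  define Q where "Q = pair_pmf (bernoulli_pmf e) (bernoulli_pmf (1 / 2))"
  define M where "M = \<mu> \<Otimes>\<^sub>M measure_pmf Q"
  interpret P: pair_prob_space \<mu> "measure_pmf Q" ..
  interpret M: prob_space M unfolding M_def by (rule P.prob_space_axioms)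
  have spM: "space M = UNIV" by (simp add: M_def space_pair_measure m)
  define Z where "Z \<omega> = (if norm (fst \<omega>) < r then r *\<^sub>R b else fst \<omega>)" for \<omega> :: "'a \<times> bool \<times> bool"
  define A B :: "('a \<times> bool \<times> bool) set" where "A = UNIV \<times> {(True, True)}" and "B = UNIV \<times> {(True, False)}"
  have fstM [measurable]: "fst \<in> M \<rightarrow>\<^sub>M borel"
    unfolding M_def by measurable
  have Zm: "Z \<in> M \<rightarrow>\<^sub>M borel"
    unfolding Z_def[abs_def] by measurable
  have sub: "UNIV \<times> {q} \<in> sets M" "emeasure M (UNIV \<times> {q}) = ennreal (pmf Q q)" for q
  proof -
    have "UNIV \<in> sets \<mu>" using m by simp
    then show "UNIV \<times> {q} \<in> sets M" unfolding M_def by simp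
    have "emeasure M (UNIV \<times> {q}) = emeasure \<mu> UNIV * emeasure (measure_pmf Q) {q}"
      unfolding M_def using \<open>UNIV \<in> sets \<mu>\<close> by (intro measure_pmf.emeasure_pair_measure_Times) auto
    then show "emeasure M (UNIV \<times> {q}) = ennreal (pmf Q q)"
      using N.emeasure_space_1 m(4) by (simp add: emeasure_pmf_single)
  qed
  have pmfQ: "pmf Q (True, x) = e / 2" for x
    unfolding Q_def pmf_pair using e by (cases x) auto
  have distr_fst: "distr M borel fst = \<mu>"
    using measure_pmf.distr_pair_fst[of \<mu>] m(2) unfolding M_def by (metis distr_cong)
  have S: "split_atom M Z A B p r e"
  proof
    show "integrable M (\<lambda>\<omega>. norm (Z \<omega>) powr p)"
    proof (rule Bochner_Integration.integrable_bound)
      have "integrable (distr M borel fst) (\<lambda>x. norm x powr p)" unfolding distr_fst by (rule m(3))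
      then have "integrable M (\<lambda>\<omega>. norm (fst \<omega>) powr p)"
        by (subst (asm) integrable_distr_eq) auto
      then show "integrable M (\<lambda>\<omega>. norm (fst \<omega>) powr p + r powr p)" by simp
      show "AE \<omega> in M. norm (norm (Z \<omega>) powr p) \<le> norm (norm (fst \<omega>) powr p + r powr p)"
        using nb by (intro AE_I2) (auto simp: Z_def)
    qed (use Zm in measurable)
    show "M.prob A = e / 2" "M.prob B = e / 2"
      using e sub(2)[of "(True, True)"] sub(2)[of "(True, False)"]
      by (simp_all add: A_def B_def pmfQ measure_def)
    show "A \<in> sets M" "B \<in> sets M" using sub(1) by (auto simp: A_def B_def)
    show "r \<le> norm (Z \<omega>)" for \<omega> using nb by (simp add: Z_def)
  qed (use p r e Zm in \<open>auto simp: A_def B_def\<close>)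
  interpret S: split_atom M Z A B p r e by (rule S)
  have joint: "(\<lambda>\<omega>. ennreal ((norm (fst \<omega>) + r) powr p) * indicator {(True, True), (True, False)} (snd \<omega>)) \<in> borel_measurable M"
  proof (rule borel_measurable_times_ennreal)
    show "(\<lambda>\<omega>. indicator {(True, True), (True, False)} (snd \<omega>) :: ennreal) \<in> borel_measurable M"
      unfolding M_def by (rule measurable_compose[OF measurable_snd]) simp
  qed measurable
  have "wasserstein_dist p \<mu> (S.\<rho> v) < \<eta>" if v: "norm v \<le> r" for v
  proof -
    let ?\<gamma> = "distr M borel (\<lambda>\<omega>. (fst \<omega>, S.Y v \<omega>))"
    have g: "?\<gamma> \<in> couplings \<mu> (S.\<rho> v)"
      by (rule couplings_distrI) (auto simp: S.\<rho>_def distr_fst M.prob_space_axioms)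
    have le: "dist (fst \<omega>) (S.Y v \<omega>) powr p \<le> (2 * r) powr p + (norm (fst \<omega>) + r) powr p * indicator {(True, True), (True, False)} (snd \<omega>)" for \<omega>
    proof (cases "\<omega> \<in> A \<union> B")
      case True
      then have "norm (S.Y v \<omega>) = norm v" by (auto simp: S.Y_def)
      then have "dist (fst \<omega>) (S.Y v \<omega>) \<le> norm (fst \<omega>) + r"
        using v norm_triangle_ineq4[of "fst \<omega>" "S.Y v \<omega>"] by (simp add: dist_norm)
      then have "dist (fst \<omega>) (S.Y v \<omega>) powr p \<le> (norm (fst \<omega>) + r) powr p"
        using p by (intro powr_mono2) auto
      then show ?thesis using True by (auto simp: A_def B_def intro!: add_increasing)
    next
      case False
      then have "dist (fst \<omega>) (S.Y v \<omega>) \<le> 2 * r"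
        using nb r norm_triangle_ineq4[of "fst \<omega>" "r *\<^sub>R b"] by (auto simp: S.Y_def Z_def dist_norm)
      then have "dist (fst \<omega>) (S.Y v \<omega>) powr p \<le> (2 * r) powr p"
        using p by (intro powr_mono2) auto
      then show ?thesis by (simp add: add_increasing2)
    qed
    have "transport_cost p ?\<gamma> = (\<integral>\<^sup>+\<omega>. ennreal (dist (fst \<omega>) (S.Y v \<omega>) powr p) \<partial>M)"
      by (rule transport_cost_distr) auto
    also have "\<dots> \<le> (\<integral>\<^sup>+\<omega>. ennreal ((2 * r) powr p) + ennreal ((norm (fst \<omega>) + r) powr p) * indicator {(True, True), (True, False)} (snd \<omega>) \<partial>M)"
    proof (rule nn_integral_mono)
      fix \<omega> :: "'a \<times> bool \<times> bool"
      show "ennreal (dist (fst \<omega>) (S.Y v \<omega>) powr p) \<le> ennreal ((2 * r) powr p) + ennreal ((norm (fst \<omega>) + r) powr p) * indicator {(True, True), (True, False)} (snd \<omega>)"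
        using le[of \<omega>] by (auto simp: indicator_def ennreal_plus[symmetric] intro!: ennreal_leI simp del: ennreal_plus)
    qed
    also have "\<dots> = ennreal ((2 * r) powr p) + (\<integral>\<^sup>+\<omega>. ennreal ((norm (fst \<omega>) + r) powr p) * indicator {(True, True), (True, False)} (snd \<omega>) \<partial>M)"
      using joint by (subst nn_integral_add) (auto simp: M.emeasure_space_1)
    also have "(\<integral>\<^sup>+\<omega>. ennreal ((norm (fst \<omega>) + r) powr p) * indicator {(True, True), (True, False)} (snd \<omega>) \<partial>M)
      = (\<integral>\<^sup>+x. ennreal ((norm x + r) powr p) * ennreal e \<partial>\<mu>)"
    proof -
      have "emeasure (measure_pmf Q) {(True, True), (True, False)} = ennreal e"
        using e by (subst emeasure_measure_pmf_finite) (auto simp: pmfQ ennreal_plus[symmetric] simp del: ennreal_plus)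
      then show ?thesis
        unfolding M_def using joint[unfolded M_def]
        by (subst measure_pmf.nn_integral_fst[symmetric]) (auto simp: nn_integral_cmult)
    qed
    also have "\<dots> = ennreal (J * e)"
      using J e J0 by (simp add: nn_integral_multc ennreal_mult)
    also have "ennreal ((2 * r) powr p) + ennreal (J * e) = ennreal ((2 * r) powr p + J * e)"
      using J0 e by simp
    also have "\<dots> \<le> ennreal ((4 * r) powr p)"
    proof (rule ennreal_leI)
      have "2 powr 1 \<le> (2::real) powr p" using p by (intro powr_mono) auto
      then have "2 * (2 * r) powr p \<le> 2 powr p * (2 * r) powr p" by (intro mult_right_mono) auto
      also have "\<dots> = (4 * r) powr p" using r by (simp add: powr_mult[symmetric])
      finally show "(2 * r) powr p + J * e \<le> (4 * r) powr p" using eJ by (simp add: mult.commute)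
    qed
    finally have "wasserstein_dist p \<mu> (S.\<rho> v) \<le> 4 * r"
      using r p0 by (intro wasserstein_le_if_coupling[OF g]) auto
    then show ?thesis using \<eta> by (simp add: r_def)
  qed
  with S show ?thesis by (rule that)
qed

section \<open>Projections to a segment\<close>

lemma metric_proj_iff:
  "s \<in> metric_proj m S x \<longleftrightarrow> s \<in> S \<and> (\<forall>s'\<in>S. mdist m x s \<le> mdist m x s')"
proof -
  have eq: "mset_dist m {x} S = (INF s'\<in>S. mdist m x s')"
  proof -
    have "(\<lambda>(a, b). mdist m a b) ` ({x} \<times> S) = (\<lambda>s'. mdist m x s') ` S" by force
    then show ?thesis unfolding mset_dist_def by simp
  qed
  have bdd: "bdd_below ((\<lambda>s'. mdist m x s') ` S)" by (rule bdd_belowI2[of _ 0]) simp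
  show ?thesis
  proof
    assume "s \<in> metric_proj m S x"
    then have s: "s \<in> S" "mdist m x s = (INF s'\<in>S. mdist m x s')" by (auto simp: metric_proj_def eq)
    then show "s \<in> S \<and> (\<forall>s'\<in>S. mdist m x s \<le> mdist m x s')" using cINF_lower[OF bdd] by auto
  next
    assume s: "s \<in> S \<and> (\<forall>s'\<in>S. mdist m x s \<le> mdist m x s')"
    then have "(INF s'\<in>S. mdist m x s') = mdist m x s"
      by (intro antisym cINF_lower[OF bdd] cINF_greatest) auto
    then show "s \<in> metric_proj m S x" using s by (simp add: metric_proj_def eq)
  qed
qed

lemma mset_dist_singletons: "mset_dist m {a} {b} = mdist m a b"
  by (simp add: mset_dist_def)

text \<open>The left side is at most 1 and the right side at least 4. The differences stay
  unsimplified to match \<open>plane_diff\<close> and \<open>plane_add\<close> for first coordinates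
  1.\<close>

lemma segment_separated:
  fixes s s' :: real
  assumes "\<bar>s\<bar> \<le> 1 / 2" "\<bar>s'\<bar> \<le> 1 / 2"
  shows "(1 - 1)\<^sup>2 + (s - s')\<^sup>2 < (1 + 1)\<^sup>2 + (s + s')\<^sup>2"
proof -
  have "\<bar>s - s'\<bar> \<le> 1" using assms by linarith
  then have "(s - s')\<^sup>2 \<le> 1" using abs_le_square_iff[of "s - s'" 1] by simp
  moreover have "(1 - 1)\<^sup>2 = (0::real)" "(1 + 1)\<^sup>2 = (4::real)" by simp_all
  ultimately show ?thesis using zero_le_power2[of "s + s'"] by linarith
qed

lemma norm_orthonormal_combination:
  fixes a b :: "'a::real_inner"
  assumes "norm a = 1" "norm b = 1" "a \<bullet> b = 0"
  shows "norm (x *\<^sub>R a + y *\<^sub>R b) = sqrt (x\<^sup>2 + y\<^sup>2)"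
proof -
  have "norm (x *\<^sub>R a + y *\<^sub>R b) ^ 2 = x\<^sup>2 * norm a ^ 2 + y\<^sup>2 * norm b ^ 2 + 2 * x * y * (a \<bullet> b)"
    unfolding power2_norm_eq_inner by (simp add: algebra_simps inner_commute power2_eq_square)
  then have "norm (x *\<^sub>R a + y *\<^sub>R b) ^ 2 = x\<^sup>2 + y\<^sup>2" using assms by simp
  from real_sqrt_unique[OF this norm_ge_zero] show ?thesis by simp
qed

section \<open>A segment in the cone and two points that project to its ends\<close>

context split_atom
begin

context
  fixes a b :: 'a
  assumes on: "norm a = 1" "norm b = 1" "a \<bullet> b = 0"
begin

text \<open>The scale \<open>r / 12\<close> bounds all vectors in use by \<open>r / 6\<close> and
  their differences by \<open>r / 3\<close>, so that the condition
  \<open>norm v + 2 * norm (v - w) < r\<close> of \<open>rho_between\<close> holds.\<close>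

definition plane :: "real \<Rightarrow> real \<Rightarrow> 'a" where
  "plane x y = (r / 12) *\<^sub>R (x *\<^sub>R a + y *\<^sub>R b)"

lemma norm_plane: "norm (plane x y) = r / 12 * sqrt (x\<^sup>2 + y\<^sup>2)"
  using r by (simp add: plane_def norm_orthonormal_combination[OF on])

lemma plane_diff: "plane x y - plane x' y' = plane (x - x') (y - y')"
  and plane_add: "plane x y + plane x' y' = plane (x + x') (y + y')"
  and plane_uminus: "- plane x y = plane (- x) (- y)"
  by (simp_all add: plane_def algebra_simps)

lemma norm_plane_le:
  assumes "\<bar>x\<bar> \<le> 1" "\<bar>y\<bar> \<le> 1 / 2"
  shows "norm (plane x y) \<le> r / 6"
proof -
  have "x\<^sup>2 \<le> 1" using assms(1) abs_le_square_iff[of x 1] by simp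
  moreover have "y\<^sup>2 \<le> (1/2)\<^sup>2" using assms(2) abs_le_square_iff[of y "1/2"] by simp
  ultimately have "x\<^sup>2 + y\<^sup>2 \<le> 2\<^sup>2" by (simp add: power2_eq_square)
  then have "sqrt (x\<^sup>2 + y\<^sup>2) \<le> 2" by (intro real_le_lsqrt) auto
  then have "r / 12 * sqrt (x\<^sup>2 + y\<^sup>2) \<le> r / 12 * 2" using r by (intro mult_left_mono) auto
  then show ?thesis by (simp add: norm_plane)
qed

lemma wasserstein_plane:
  assumes "\<bar>x\<bar> \<le> 1" "\<bar>y\<bar> \<le> 1 / 2" "\<bar>x'\<bar> \<le> 1" "\<bar>y'\<bar> \<le> 1 / 2"
    and sep: "(x - x')\<^sup>2 + (y - y')\<^sup>2 \<le> (x + x')\<^sup>2 + (y + y')\<^sup>2"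
  shows "wasserstein_dist p (\<rho> (plane x y)) (\<rho> (plane x' y'))
    = e powr (1 / p) * (r / 12) * sqrt ((x - x')\<^sup>2 + (y - y')\<^sup>2)"
proof -
  have n: "norm (plane x y) \<le> r / 6" "norm (plane x' y') \<le> r / 6"
    using norm_plane_le[OF assms(1,2)] norm_plane_le[OF assms(3,4)] .
  have "norm (plane x y - plane x' y') \<le> norm (plane x y) + norm (plane x' y')"
    by (rule norm_triangle_ineq4)
  then have "wasserstein_dist p (\<rho> (plane x y)) (\<rho> (plane x' y')) = e powr (1 / p) * norm (plane x y - plane x' y')"
  proof (intro wasserstein_rho)
    show "norm (plane x y - plane x' y') \<le> norm (plane x y + plane x' y')"
      unfolding plane_diff plane_add norm_plane using r sep by (intro mult_left_mono) auto
  qed (use n r in linarith)+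
  then show ?thesis by (simp add: plane_diff norm_plane)
qed

abbreviation segment :: "real \<Rightarrow> 'a measure" where
  "segment s \<equiv> \<rho> (plane 1 s)"

lemma wasserstein_segment:
  assumes "\<bar>s\<bar> \<le> 1 / 2" "\<bar>s'\<bar> \<le> 1 / 2"
  shows "wasserstein_dist p (segment s) (segment s') = e powr (1 / p) * (r / 12) * \<bar>s - s'\<bar>"
proof -
  from wasserstein_plane[OF _ _ _ _ less_imp_le[OF segment_separated[OF assms]]] show ?thesis using assms by simp
qed

lemma segment_between:
  assumes s: "\<bar>s\<bar> \<le> 1 / 2" "\<bar>s'\<bar> \<le> 1 / 2" and \<nu>: "\<nu> \<in> prob_measures_moment p" and t: "t \<in> {0..1}"
    and d1: "wasserstein_dist p (segment s) \<nu> = t * wasserstein_dist p (segment s) (segment s')"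
    and d2: "wasserstein_dist p \<nu> (segment s') = (1 - t) * wasserstein_dist p (segment s) (segment s')"
  shows "\<nu> = segment ((1 - t) * s + t * s')"
proof -
  have p0: "0 < p" using p by simp
  consider "t = 0 \<or> s = s'" | "t = 1" | "0 < t" "t < 1" "s \<noteq> s'" using t by fastforce
  then show ?thesis
  proof cases
    case 1
    then have "wasserstein_dist p (segment s) \<nu> = 0" using d1 wasserstein_segment[OF s] by auto
    then have "segment s = \<nu>" by (rule wasserstein_zero_imp_eq[OF rho_in_moment \<nu> p0])
    moreover have "(1 - t) * s + t * s' = s" using 1 by (auto simp: algebra_simps)
    ultimately show ?thesis by simp
  next
    case 2
    then have "wasserstein_dist p \<nu> (segment s') = 0" using d2 by simp
    then have "\<nu> = segment s'" by (rule wasserstein_zero_imp_eq[OF \<nu> rho_in_moment p0])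
    then show ?thesis using 2 by simp
  next
    case 3
    have n: "norm (plane 1 s) \<le> r / 6" "norm (plane 1 s') \<le> r / 6"
      using norm_plane_le[of 1 s] norm_plane_le[of 1 s'] s by simp_all
    have le: "norm (plane 1 s - plane 1 s') \<le> norm (plane 1 s) + norm (plane 1 s')"
      by (rule norm_triangle_ineq4)
    have "norm (plane 1 s - plane 1 s') < norm (plane 1 s + plane 1 s')"
      unfolding plane_diff plane_add norm_plane using r segment_separated[OF s]
      by (intro mult_strict_left_mono real_sqrt_less_mono) auto
    moreover have "norm (plane 1 s - plane 1 s') \<noteq> 0"
      using 3 r by (simp add: plane_diff norm_plane)
    ultimately have "\<nu> = \<rho> ((1 - t) *\<^sub>R plane 1 s + t *\<^sub>R plane 1 s')"
      using 3 n le r by (intro rho_between[OF \<nu> _ _ _ _ _ _ d1 d2]) auto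
    also have "(1 - t) *\<^sub>R plane 1 s + t *\<^sub>R plane 1 s' = plane 1 ((1 - t) * s + t * s')"
    proof -
      have "(1 - t) *\<^sub>R k *\<^sub>R (1 *\<^sub>R a + s *\<^sub>R b) + t *\<^sub>R k *\<^sub>R (1 *\<^sub>R a + s' *\<^sub>R b)
          = k *\<^sub>R (1 *\<^sub>R a + ((1 - t) * s + t * s') *\<^sub>R b)" for k
        by (simp add: algebra_simps)
      then show ?thesis unfolding plane_def .
    qed
    finally show ?thesis .
  qed
qed

text \<open>The distance to a point of the segment is Lipschitz in its parameter, which ranges over
  a compact interval. This gives proximinality.\<close>

lemma segment_nearest:
  assumes \<mu>: "\<mu> \<in> prob_measures_moment p"
  obtains s where "\<bar>s\<bar> \<le> 1 / 2"
    "\<And>s'. \<bar>s'\<bar> \<le> 1 / 2 \<Longrightarrow> wasserstein_dist p \<mu> (segment s) \<le> wasserstein_dist p \<mu> (segment s')"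
proof -
  interpret W: Metric_space "prob_measures_moment p :: 'a measure set" "wasserstein_dist p"
    using p by (intro Metric_space_wasserstein) simp
  let ?I = "{- 1 / 2..1 / 2 :: real}"
  have I: "s \<in> ?I \<longleftrightarrow> \<bar>s\<bar> \<le> 1 / 2" for s by auto
  have "(e powr (1 / p) * (r / 12))-lipschitz_on ?I (\<lambda>s. wasserstein_dist p \<mu> (segment s))"
  proof (rule lipschitz_onI)
    fix s s' assume "s \<in> ?I" "s' \<in> ?I"
    then have d: "wasserstein_dist p (segment s) (segment s') = e powr (1 / p) * (r / 12) * dist s s'"
      unfolding I by (simp add: wasserstein_segment dist_real_def)
    have "\<bar>wasserstein_dist p \<mu> (segment s) - wasserstein_dist p \<mu> (segment s')\<bar>
        \<le> wasserstein_dist p (segment s) (segment s')"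
      using W.triangle[OF \<mu> rho_in_moment[of "plane 1 s"] rho_in_moment[of "plane 1 s'"]]
        W.triangle[OF \<mu> rho_in_moment[of "plane 1 s'"] rho_in_moment[of "plane 1 s"]]
        W.commute[of "segment s" "segment s'"] by linarith
    then show "dist (wasserstein_dist p \<mu> (segment s)) (wasserstein_dist p \<mu> (segment s'))
        \<le> e powr (1 / p) * (r / 12) * dist s s'"
      by (simp add: d dist_real_def[of "wasserstein_dist p \<mu> (segment s)"])
  qed (use r in auto)
  then have "continuous_on ?I (\<lambda>s. wasserstein_dist p \<mu> (segment s))"
    by (rule lipschitz_on_continuous_on)
  then have "\<exists>s\<in>?I. \<forall>s'\<in>?I. wasserstein_dist p \<mu> (segment s) \<le> wasserstein_dist p \<mu> (segment s')"
    by (intro continuous_attains_inf) auto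
  then show ?thesis using that unfolding Bex_def Ball_def I by blast
qed

lemma nearest_unique:
  assumes \<sigma>: "\<bar>\<sigma>\<bar> = 1 / 2" and s: "\<bar>s\<bar> \<le> 1 / 2"
    and le: "wasserstein_dist p (\<rho> (plane (1 / 4) \<sigma>)) (segment s)
      \<le> wasserstein_dist p (\<rho> (plane (1 / 4) \<sigma>)) (segment \<sigma>)"
  shows "s = \<sigma>"
proof -
  have d: "wasserstein_dist p (\<rho> (plane (1 / 4) \<sigma>)) (segment s)
      = e powr (1 / p) * (r / 12) * sqrt ((1 / 4 - 1)\<^sup>2 + (\<sigma> - s)\<^sup>2)" if s: "\<bar>s\<bar> \<le> 1 / 2" for s
  proof (rule wasserstein_plane)
    \<comment> \<open>The separation condition amounts to
      \<open>1 / 4 + \<sigma> * s \<ge> 0\<close>. This determines the first coordinate: below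
      \<open>1 / 4\<close> it would fail at \<open>s = - \<sigma>\<close>.\<close>
    have "\<bar>\<sigma> * s\<bar> = 1 / 2 * \<bar>s\<bar>" unfolding abs_mult \<sigma> ..
    then have "- (\<sigma> * s) \<le> 1 / 4" using s by linarith
    then show "(1 / 4 - 1)\<^sup>2 + (\<sigma> - s)\<^sup>2 \<le> (1 / 4 + 1)\<^sup>2 + (\<sigma> + s)\<^sup>2"
      by (simp add: power2_eq_square algebra_simps)
  qed (use \<sigma> s in auto)
  have pos: "0 < e powr (1 / p) * (r / 12)" using e r by simp
  have "e powr (1 / p) * (r / 12) * sqrt ((1 / 4 - 1)\<^sup>2 + (\<sigma> - s)\<^sup>2)
      \<le> e powr (1 / p) * (r / 12) * sqrt ((1 / 4 - 1)\<^sup>2 + (\<sigma> - \<sigma>)\<^sup>2)"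
    using le unfolding d[OF s] d[OF \<sigma>[THEN eq_refl]] .
  then have "sqrt ((1 / 4 - 1)\<^sup>2 + (\<sigma> - s)\<^sup>2) \<le> sqrt ((1 / 4 - 1)\<^sup>2 + (\<sigma> - \<sigma>)\<^sup>2)"
    by (rule mult_left_le_imp_le[OF _ pos])
  then have "(1 / 4 - 1)\<^sup>2 + (\<sigma> - s)\<^sup>2 \<le> (1 / 4 - 1)\<^sup>2 + (\<sigma> - \<sigma>)\<^sup>2"
    by (simp only: real_sqrt_le_iff)
  then show ?thesis by simp
qed

text \<open>By \<open>rho_minus\<close> the second point may be replaced by its antipode, which
  differs from the first by \<open>1 / 2\<close> in the first coordinate; this is the shortcut
  around the apex.\<close>

lemma wasserstein_across:
  "wasserstein_dist p (\<rho> (plane (1 / 4) (1 / 2))) (\<rho> (plane (1 / 4) (- 1 / 2)))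
    = e powr (1 / p) * (r / 12) * (1 / 2)"
proof -
  have "\<rho> (plane (1 / 4) (- 1 / 2)) = \<rho> (plane (- 1 / 4) (1 / 2))"
    using rho_minus[of "plane (1 / 4) (- 1 / 2)"] by (simp add: plane_uminus)
  then have "wasserstein_dist p (\<rho> (plane (1 / 4) (1 / 2))) (\<rho> (plane (1 / 4) (- 1 / 2)))
    = e powr (1 / p) * (r / 12) * sqrt ((1 / 4 - - 1 / 4)\<^sup>2 + (1 / 2 - 1 / 2)\<^sup>2)"
    by (simp only:) (rule wasserstein_plane; simp add: power2_eq_square)
  then show ?thesis by simp
qed

end

end

section \<open>The contradiction inside an arbitrary member of the cover\<close>

theorem theorem4p9:
  fixes p :: real and X :: "(real ^ 'd) measure set"
  assumes "CARD('d) \<ge> 2" and "1 < p"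
    and "openin (mtopology_of (wasserstein_space p)) X" and "X \<noteq> {}"
  shows "\<not> projection_criterion (submetric (wasserstein_space p) X)"
proof
  let ?P = "prob_measures_moment p :: (real ^ 'd) measure set"
  let ?W = "wasserstein_space p :: (real ^ 'd) measure metric"
  let ?m = "submetric ?W X"
  have p1: "p \<ge> 1" using assms by simp
  interpret W: Metric_space ?P "wasserstein_dist p" by (rule Metric_space_wasserstein[OF p1])
  have top: "mtopology_of ?W = W.mtopology"
    by (simp add: mtopology_of_def mspace_wasserstein_space[OF p1] mdist_wasserstein_space[OF p1])
  have XP: "X \<subseteq> ?P" using assms(3) unfolding top W.openin_mtopology by simp
  have space: "mspace ?m = X" using XP by (auto simp: mspace_wasserstein_space[OF p1])
  have md: "mdist ?m = wasserstein_dist p" by (simp add: mdist_wasserstein_space[OF p1])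
  assume "projection_criterion ?m"
  then have "\<exists>\<U>. \<Union>\<U> = X \<and> (\<forall>U\<in>\<U>. openin (mtopology_of ?m) U \<and> geodesic_space (submetric ?m U) \<and>
      (\<forall>S. S \<subseteq> U \<and> geodesically_convex ?m S \<and> proximinal ?m U S \<longrightarrow>
        (\<forall>x\<in>U. \<forall>y\<in>U. mset_dist ?m (metric_proj ?m S x) (metric_proj ?m S y) \<le> mdist ?m x y)))"
    unfolding projection_criterion_def space .
  then obtain \<U> where \<U>: "\<Union>\<U> = X" and "\<forall>U\<in>\<U>. openin (mtopology_of ?m) U \<and> geodesic_space (submetric ?m U) \<and>
      (\<forall>S. S \<subseteq> U \<and> geodesically_convex ?m S \<and> proximinal ?m U S \<longrightarrow>
        (\<forall>x\<in>U. \<forall>y\<in>U. mset_dist ?m (metric_proj ?m S x) (metric_proj ?m S y) \<le> mdist ?m x y))"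
    by (elim exE conjE)
  then have U_open: "openin (mtopology_of ?m) U"
    and contracting: "S \<subseteq> U \<Longrightarrow> geodesically_convex ?m S \<Longrightarrow> proximinal ?m U S \<Longrightarrow> x \<in> U \<Longrightarrow> y \<in> U \<Longrightarrow>
      mset_dist ?m (metric_proj ?m S x) (metric_proj ?m S y) \<le> mdist ?m x y"
    if "U \<in> \<U>" for U S x y
    using that by simp_all
  obtain \<mu> U where U: "U \<in> \<U>" "\<mu> \<in> U" using assms(4) \<U> by auto
  have "openin (subtopology (mtopology_of ?W) X) U"
    using U_open[OF U(1)] by (simp add: mtopology_of_submetric)
  then have UX: "U \<subseteq> X" and "openin W.mtopology U"
    using openin_open_subtopology[OF assms(3)] by (auto simp: top)
  then obtain \<eta> where \<eta>: "\<eta> > 0" "W.mball \<mu> \<eta> \<subseteq> U"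
    using U(2) unfolding W.openin_mtopology by blast
  have \<mu>P: "\<mu> \<in> ?P" using U(2) UX XP by blast
  obtain M :: "((real ^ 'd) \<times> bool \<times> bool) measure" and Z A B r e
    where SA: "split_atom M Z A B p r e"
      and near: "\<And>v. norm v \<le> r \<Longrightarrow> wasserstein_dist p \<mu> (split_atom.\<rho> M Z A B v) < \<eta>"
    using split_atom_near[OF \<mu>P assms(2) \<eta>(1)] by blast
  interpret split_atom M Z A B p r e by (rule SA)
  have in_U: "\<rho> v \<in> U" if "norm v \<le> r" for v
    using near[OF that] \<eta>(2) \<mu>P rho_in_moment[of v] by (auto simp: W.in_mball)
  have "\<not> CARD('d) \<le> Suc 0" using assms(1) by simp
  then obtain i j :: 'd where ij: "i \<noteq> j"
    using card_le_Suc0_iff_eq[of "UNIV :: 'd set"] by auto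
  define a b :: "real ^ 'd" where "a = axis i 1" and "b = axis j 1"
  have on: "norm a = 1" "norm b = 1" "a \<bullet> b = 0"
    using ij by (simp_all add: a_def b_def inner_axis_axis)
  let ?q = "\<lambda>s. \<rho> (plane a b 1 s)" and ?x = "\<lambda>s. \<rho> (plane a b (1 / 4) s)"
  define S where "S = ?q ` {s. \<bar>s\<bar> \<le> 1 / 2}"
  define k where "k = e powr (1 / p) * (r / 12)"
  have k: "k > 0" using e r by (simp add: k_def)
  have plane_U: "\<rho> (plane a b x y) \<in> U" if "\<bar>x\<bar> \<le> 1" "\<bar>y\<bar> \<le> 1 / 2" for x y
    using norm_plane_le[OF on that] r by (intro in_U) simp
  then have SU: "S \<subseteq> U" by (auto simp: S_def)
  \<comment> \<open>Each point of a geodesic is determined by its distances to the two ends, by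
    \<open>segment_between\<close>, and so lies on the segment.\<close>
  have convex: "geodesically_convex ?m S"
    unfolding geodesically_convex_def space
  proof (intro conjI ballI allI impI)
    show "S \<subseteq> X" using SU UX by blast
    fix x y g assume "x \<in> S" "y \<in> S" and g: "geodesic_from_to ?m g x y"
    then obtain s s' where s: "\<bar>s\<bar> \<le> 1 / 2" "\<bar>s'\<bar> \<le> 1 / 2" "x = ?q s" "y = ?q s'"
      by (auto simp: S_def)
    have gd: "g 0 = ?q s" "g 1 = ?q s'"
      "\<And>t u. t \<in> {0..1} \<Longrightarrow> u \<in> {0..1} \<Longrightarrow>
        wasserstein_dist p (g t) (g u) = \<bar>t - u\<bar> * wasserstein_dist p (?q s) (?q s')"
      using g unfolding geodesic_from_to_def md s(3,4) by auto
    show "g ` {0..1} \<subseteq> S"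
    proof
      fix \<nu> assume "\<nu> \<in> g ` {0..1}"
      then obtain t where t: "t \<in> {0..1}" "\<nu> = g t" by blast
      have "\<nu> \<in> ?P" using g t XP unfolding geodesic_from_to_def space by blast
      moreover have "wasserstein_dist p (?q s) \<nu> = t * wasserstein_dist p (?q s) (?q s')"
        using gd(3)[of 0 t] t by (simp add: gd(1))
      moreover have "wasserstein_dist p \<nu> (?q s') = (1 - t) * wasserstein_dist p (?q s) (?q s')"
        using gd(3)[of t 1] t by (simp add: gd(2))
      ultimately have "\<nu> = ?q ((1 - t) * s + t * s')"
        by (rule segment_between[OF on s(1,2) _ t(1)])
      moreover have "\<bar>(1 - t) * s + t * s'\<bar> \<le> 1 / 2"
      proof -
        have "\<bar>(1 - t) * s + t * s'\<bar> \<le> (1 - t) * \<bar>s\<bar> + t * \<bar>s'\<bar>"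
          using t(1) abs_triangle_ineq[of "(1 - t) * s" "t * s'"] by (simp add: abs_mult)
        also have "\<dots> \<le> (1 - t) * (1 / 2) + t * (1 / 2)"
          using t(1) s by (intro add_mono mult_left_mono) auto
        also have "\<dots> = 1 / 2" by (simp add: field_simps)
        finally show ?thesis .
      qed
      ultimately show "\<nu> \<in> S" by (auto simp: S_def)
    qed
  qed
  have prox: "proximinal ?m U S"
    unfolding proximinal_def space
  proof (intro conjI ballI SU UX)
    fix x assume "x \<in> U"
    then have "x \<in> ?P" using UX XP by blast
    from segment_nearest[OF on this] obtain s where "\<bar>s\<bar> \<le> 1 / 2"
      "\<And>s'. \<bar>s'\<bar> \<le> 1 / 2 \<Longrightarrow> wasserstein_dist p x (?q s) \<le> wasserstein_dist p x (?q s')"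
      by blast
    then have "?q s \<in> metric_proj ?m S x" unfolding metric_proj_iff md by (auto simp: S_def)
    then show "metric_proj ?m S x \<noteq> {}" by blast
  qed
  have proj: "metric_proj ?m S (?x \<sigma>) = {?q \<sigma>}" if \<sigma>: "\<bar>\<sigma>\<bar> = 1 / 2" for \<sigma>
  proof -
    have "metric_proj ?m S (?x \<sigma>) \<noteq> {}"
      using prox plane_U[of "1 / 4" \<sigma>] \<sigma> unfolding proximinal_def by simp
    moreover have "metric_proj ?m S (?x \<sigma>) \<subseteq> {?q \<sigma>}"
    proof
      fix \<nu> assume "\<nu> \<in> metric_proj ?m S (?x \<sigma>)"
      then have "\<nu> \<in> S" and le: "\<And>\<nu>'. \<nu>' \<in> S \<Longrightarrow> wasserstein_dist p (?x \<sigma>) \<nu> \<le> wasserstein_dist p (?x \<sigma>) \<nu>'"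
        unfolding metric_proj_iff md by auto
      then obtain s where s: "\<bar>s\<bar> \<le> 1 / 2" "\<nu> = ?q s" by (auto simp: S_def)
      have "?q \<sigma> \<in> S" using \<sigma> by (auto simp: S_def)
      from nearest_unique[OF on \<sigma> s(1) le[OF this, unfolded s(2)]] show "\<nu> \<in> {?q \<sigma>}"
        using s(2) by simp
    qed
    ultimately show ?thesis by blast
  qed
  \<comment> \<open>The projections are the two ends of the segment, at distance \<open>k\<close>,
    while the projected points are only \<open>k / 2\<close> apart.\<close>
  have "mset_dist ?m (metric_proj ?m S (?x (1 / 2))) (metric_proj ?m S (?x (- 1 / 2)))
      \<le> mdist ?m (?x (1 / 2)) (?x (- 1 / 2))"
    by (rule contracting[OF U(1) SU convex prox]) (auto intro!: plane_U)
  also have "mset_dist ?m (metric_proj ?m S (?x (1 / 2))) (metric_proj ?m S (?x (- 1 / 2))) = k"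
    by (simp add: proj mset_dist_singletons md wasserstein_segment[OF on] k_def del: mdist_submetric)
  also have "mdist ?m (?x (1 / 2)) (?x (- 1 / 2)) = k * (1 / 2)"
    unfolding md wasserstein_across[OF on] k_def by simp
  finally show False using k by simp
qed

end
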